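(* For every integer $t\ge 0$, deleting row $12$ of $K_t$, together with the complete two-edges $B_{19}$ and $B_{17}$ (that is, deleting the one-edge at $(12,4)$ and the two-edges $B_{19}$, $B_{17}$ with all cells of their supports, and then removing the resulting empty row $12$ and relabelling the rows), gives a configuration on $15+2t$ rows and $4$ columns that is admissible (feasible in the definition of $z_{\mathrm{RL}}(15+2t,4)$, in particular satisfying $(\mathrm{RW3}^{+})$) and extremal (its number of selected edges equals $z_{\mathrm{RL}}(15+2t,4)$), and it has exactly one hole and $40+5t$ selected edges.
   Context: For a positive integer $r$ put $[r]=\{1,\dots,r\}$. Elements of the grid $[m]\times[n]$ are called cells; $(i,j)$ is in row $i$ and column $j$. A genuine rectangle is given by rows $i\ne k$ and columns $j\ne \ell$; it has the two diagonals $\{(i,j),(k,\ell)\}$ and $\{(i,\ell),(k,j)\}$. The classical Zarankiewicz number $z(m,n)$ is the maximum size of a set of cells of $[m]\times[n]$ containing no genuine rectangle with all four corners in the set (such a set, viewed as a bipartite graph, is called $C_4$-free). An augmented configuration $G=([m],[n],E_1\cup E_2)$ consists of a set $E_1$ of cells (one-edges) and a set $E_2$ of two-edges, a two-edge being an unordered pair of distinct cells (the two cells may share a row or a column). The support of a one-edge $(i,j)$ is $\{(i,j)\}$; the support of a two-edge $\{p,q\}$ is $\{p,q\}$. $G$ satisfies condition (S), i.e. is simple, if distinct selected edges (elements of $E_1\cup E_2$) have disjoint supports. Let $\Omega=E_1\cup\bigcup_{e\in E_2}e$ be the set of occupied cells; the other cells are holes; $N(G)=|E_1|+|E_2|$ is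 the number of selected edges. For distinct cells $p,q$ put $\delta(p,q)=1$ if $\{p,q\}\in E_2$ and $\delta(p,q)=0$ otherwise. The strengthened closure of $G$ consists of the least equivalence relation $\sim$ on $\Omega$ and the least symmetric relation $\perp_R$ on $\Omega$ jointly closed under the following rules (only consequences of finitely many rule applications are certified): - Line rule: for distinct occupied cells $p,q$ in the same row or the same column, if $\delta(p,q)=0$ add $p\perp_R q$; if $\delta(p,q)=1$ add $p\sim q$. - Saturation rule: if $p\sim p'$, $q\sim q'$ and $p'\perp_R q'$, add $p\perp_R q$. - Rectangle transfer: let a genuine rectangle have diagonals $\{p,q\}$ (target) and $\{r,s\}$ (companion). Suppose the companion is certified to have its prescribed value: if $\delta(r,s)=0$, this means at least one of $r,s$ is a hole or $r\perp_R s$; if $\delta(r,s)=1$, it means $r,s$ are both occupied and $r\sim s$. Then, if $p,q$ are occupied and $\delta(p,q)=0$, add $p\perp_R q$; if $\delta(p,q)=1$, add $p\sim q$. - Complementary-pair rule: if both diagonals $\{p,q\}$, $\{r,s\}$ of a genuine rectangle are in $E_2$, add $p\sim q$ and $r\sim s$. A simple configuration satisfies $(\mathrm{RW3}^{+})$ if in its strengthened closure: every two-edge $\{p,q\}\in E_2$ has $p\sim q$; distinct selected edges determine distinct $\sim$-classes; and for any two distinct selected edges $e,f$ there are $p\in\operatorname{supp}(e)$, $q\in\operatorname{supp}(f)$ with $p\perp_R q$. The recursive-line Zarankiewicz number $z_{\mathrm{RL}}(m,n)$ is the maximum of $N(G)$ over all augmented configurations $G$ on $[m]\times[n]$ such that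 $|E_1|=z(m,n)$, $G$ satisfies (S), $E_1$ is $C_4$-free, and $G$ satisfies $(\mathrm{RW3}^{+})$. The seed $K_0$ is the $16\times 4$ configuration given by the following matrix, where each $\bullet$ is a separate one-edge and each integer $j$ appears in exactly two cells, which form the two-edge $B_j$ ($1\le j\le 21$): $$\begin{array}{c|cccc}&1&2&3&4\\\hline 1&\bullet&1&\bullet&1\\ 2&2&\bullet&\bullet&3\\ 3&4&5&\bullet&\bullet\\ 4&\bullet&\bullet&6&7\\ 5&\bullet&9&8&\bullet\\ 6&6&\bullet&10&\bullet\\ 7&12&\bullet&11&13\\ 8&7&\bullet&13&11\\ 9&15&16&14&\bullet\\ 10&17&14&16&\bullet\\ 11&18&10&15&\bullet\\ 12&19&17&19&\bullet\\ 13&3&8&12&\bullet\\ 14&21&21&20&\bullet\\ 15&5&20&18&\bullet\\ 16&9&4&2&\bullet\end{array}$$ For $t\ge1$, $K_t$ is the configuration on $16+2t$ rows and $4$ columns defined as follows. Rows $1,\dots,15$ are as in $K_0$, except that the label of cell $(2,1)$ is replaced by $A_0$ and the label of cell $(3,1)$ by $S_0$. With $u_i=14+2i$, $v_i=15+2i$ $(1\le i\le t)$ and $w=16+2t$, the remaining rows are (columns $1,2,3,4$ in order) $$u_i:\ (A_i,\,U_i,\,A_{i-1},\,R_i),\qquad v_i:\ (S_i,\,S_{i-1},\,V_i,\,R_i),\qquad w:\ (B_9,\,S_t,\,A_t,\,W).$$ Here $U_i,V_i,W$ are distinct one-edges; each of the labels $A_0,\dots,A_t$, $S_0,\dots,S_t$,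 $R_1,\dots,R_t$ occurs in exactly two cells, which form the two-edge of that name; the two-edges $B_j$ with $j\ne 2,4$ are retained (with $B_9=\{(5,2),(w,1)\}$), and $B_2,B_4$ are no longer present. *)

theory Defs
  imports Main
begin

section \<open>Augmented configurations\<close>

type_synonym cell = "nat \<times> nat"

definition grid :: "nat \<Rightarrow> nat \<Rightarrow> cell set" where
  "grid m n = {1..m} \<times> {1..n}"

definition C4_free :: "cell set \<Rightarrow> bool" where
  "C4_free E \<longleftrightarrow> \<not> (\<exists>i k j l. i \<noteq> k \<and> j \<noteq> l \<and> {(i, j), (k, l), (i, l), (k, j)} \<subseteq> E)"

definition zarankiewicz :: "nat \<Rightarrow> nat \<Rightarrow> nat" where
  "zarankiewicz m n = Max {card E | E. E \<subseteq> grid m n \<and> C4_free E}"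

record config =
  nrows :: nat
  ncols :: nat
  one_edges :: "cell set"
  two_edges :: "cell set set"

definition cells :: "config \<Rightarrow> cell set" where
  "cells G = grid (nrows G) (ncols G)"

definition augmented_config :: "config \<Rightarrow> bool" where
  "augmented_config G \<longleftrightarrow>
     one_edges G \<subseteq> cells G \<and> (\<forall>e \<in> two_edges G. e \<subseteq> cells G \<and> card e = 2)"

text \<open>A selected edge is represented by its support: a one-edge at \<open>c\<close> by \<open>{c}\<close>, a two-edge
  by the pair itself. As two-edges have two elements, this identification is injective.\<close>

definition selected :: "config \<Rightarrow> cell set set" where
  "selected G = (\<lambda>c. {c}) ` one_edges G \<union> two_edges G"

definition num_edges :: "config \<Rightarrow> nat" where
  "num_edges G = card (one_edges G) + card (two_edges G)"

definition simple :: "config \<Rightarrow> bool" where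
  "simple G \<longleftrightarrow> (\<forall>e \<in> selected G. \<forall>f \<in> selected G. e \<noteq> f \<longrightarrow> e \<inter> f = {})"

definition occupied :: "config \<Rightarrow> cell set" where
  "occupied G = one_edges G \<union> \<Union> (two_edges G)"

definition holes :: "config \<Rightarrow> cell set" where
  "holes G = cells G - occupied G"


section \<open>The strengthened closure\<close>

text \<open>\<open>linked G p q\<close> says that \<open>\<delta>(p, q) = 1\<close>.\<close>

definition linked :: "config \<Rightarrow> cell \<Rightarrow> cell \<Rightarrow> bool" where
  "linked G p q \<longleftrightarrow> {p, q} \<in> two_edges G"

text \<open>\<open>diagonals G p q r s\<close>: the two diagonals of some genuine rectangle of the grid
  are \<open>{p, q}\<close> and \<open>{r, s}\<close>.\<close>

definition diagonals :: "config \<Rightarrow> cell \<Rightarrow> cell \<Rightarrow> cell \<Rightarrow> cell \<Rightarrow> bool" where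
  "diagonals G p q r s \<longleftrightarrow>
     (\<exists>i k j l. {i, k} \<subseteq> {1..nrows G} \<and> {j, l} \<subseteq> {1..ncols G} \<and> i \<noteq> k \<and> j \<noteq> l \<and>
        p = (i, j) \<and> q = (k, l) \<and> r = (i, l) \<and> s = (k, j))"

inductive sim :: "config \<Rightarrow> cell \<Rightarrow> cell \<Rightarrow> bool"
  and perp :: "config \<Rightarrow> cell \<Rightarrow> cell \<Rightarrow> bool"
  for G :: config
where
  sim_refl: "p \<in> occupied G \<Longrightarrow> sim G p p"
| sim_sym: "sim G p q \<Longrightarrow> sim G q p"
| sim_trans: "sim G p q \<Longrightarrow> sim G q r \<Longrightarrow> sim G p r"
| perp_sym: "perp G p q \<Longrightarrow> perp G q p"
| line_perp:
    "p \<in> occupied G \<Longrightarrow> q \<in> occupied G \<Longrightarrow> p \<noteq> q \<Longrightarrow> fst p = fst q \<or> snd p = snd q \<Longrightarrow>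
     \<not> linked G p q \<Longrightarrow> perp G p q"
| line_sim:
    "p \<in> occupied G \<Longrightarrow> q \<in> occupied G \<Longrightarrow> p \<noteq> q \<Longrightarrow> fst p = fst q \<or> snd p = snd q \<Longrightarrow>
     linked G p q \<Longrightarrow> sim G p q"
| saturation: "sim G p p' \<Longrightarrow> sim G q q' \<Longrightarrow> perp G p' q' \<Longrightarrow> perp G p q"
| transfer_perp:
    "diagonals G p q r s \<Longrightarrow>
     (\<not> linked G r s \<and> (r \<in> holes G \<or> s \<in> holes G \<or> perp G r s)) \<or>
     (linked G r s \<and> r \<in> occupied G \<and> s \<in> occupied G \<and> sim G r s) \<Longrightarrow>
     p \<in> occupied G \<Longrightarrow> q \<in> occupied G \<Longrightarrow> \<not> linked G p q \<Longrightarrow> perp G p q"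
| transfer_sim:
    "diagonals G p q r s \<Longrightarrow>
     (\<not> linked G r s \<and> (r \<in> holes G \<or> s \<in> holes G \<or> perp G r s)) \<or>
     (linked G r s \<and> r \<in> occupied G \<and> s \<in> occupied G \<and> sim G r s) \<Longrightarrow>
     linked G p q \<Longrightarrow> sim G p q"
| complementary:
    \<comment> \<open>The conclusion \<open>r \<sim> s\<close> is the instance for the reflected rectangle.\<close>
    "diagonals G p q r s \<Longrightarrow> linked G p q \<Longrightarrow> linked G r s \<Longrightarrow> sim G p q"

definition edge_class :: "config \<Rightarrow> cell set \<Rightarrow> cell set" where
  "edge_class G e = {q. \<exists>p \<in> e. sim G p q}"

text \<open>Under the first condition below, the cells of a selected edge all lie in one class, and
  \<open>edge_class\<close> is that class.\<close>

definition RW3_plus :: "config \<Rightarrow> bool" where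
  "RW3_plus G \<longleftrightarrow>
     (\<forall>p q. {p, q} \<in> two_edges G \<longrightarrow> sim G p q) \<and>
     inj_on (edge_class G) (selected G) \<and>
     (\<forall>e \<in> selected G. \<forall>f \<in> selected G. e \<noteq> f \<longrightarrow> (\<exists>p \<in> e. \<exists>q \<in> f. perp G p q))"

definition admissible :: "config \<Rightarrow> bool" where
  "admissible G \<longleftrightarrow>
     augmented_config G \<and>
     card (one_edges G) = zarankiewicz (nrows G) (ncols G) \<and>
     simple G \<and> C4_free (one_edges G) \<and> RW3_plus G"

definition z_RL :: "nat \<Rightarrow> nat \<Rightarrow> nat" where
  "z_RL m n = Max {num_edges G | G. nrows G = m \<and> ncols G = n \<and> admissible G}"


section \<open>Deleting edges and rows\<close>

definition delete_edges :: "cell set \<Rightarrow> cell set set \<Rightarrow> config \<Rightarrow> config" where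
  "delete_edges D1 D2 G =
     G\<lparr>one_edges := one_edges G - D1, two_edges := two_edges G - D2\<rparr>"

text \<open>Removal of row \<open>r\<close>, moving the later rows up by one; meant for a row without occupied
  cells.\<close>

definition shift_row :: "nat \<Rightarrow> cell \<Rightarrow> cell" where
  "shift_row r c = (if fst c > r then fst c - 1 else fst c, snd c)"

definition remove_row :: "nat \<Rightarrow> config \<Rightarrow> config" where
  "remove_row r G =
     \<lparr>nrows = nrows G - 1, ncols = ncols G,
      one_edges = shift_row r ` one_edges G,
      two_edges = (\<lambda>e. shift_row r ` e) ` two_edges G\<rparr>"


section \<open>The configurations \<open>K\<^sub>t\<close>\<close>

text \<open>\<open>Dot\<close> marks a one-edge of its own (a bullet, or one of \<open>U\<^sub>i\<close>, \<open>V\<^sub>i\<close>, \<open>W\<close>). Each of the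
  other labels names a two-edge, consisting of the cells that carry it.\<close>

datatype label = Dot | LB nat | LA nat | LS nat | LR nat

definition K0_rows :: "label list list" where
  "K0_rows =
    [[Dot, LB 1, Dot, LB 1],
     [LB 2, Dot, Dot, LB 3],
     [LB 4, LB 5, Dot, Dot],
     [Dot, Dot, LB 6, LB 7],
     [Dot, LB 9, LB 8, Dot],
     [LB 6, Dot, LB 10, Dot],
     [LB 12, Dot, LB 11, LB 13],
     [LB 7, Dot, LB 13, LB 11],
     [LB 15, LB 16, LB 14, Dot],
     [LB 17, LB 14, LB 16, Dot],
     [LB 18, LB 10, LB 15, Dot],
     [LB 19, LB 17, LB 19, Dot],
     [LB 3, LB 8, LB 12, Dot],
     [LB 21, LB 21, LB 20, Dot],
     [LB 5, LB 20, LB 18, Dot],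
     [LB 9, LB 4, LB 2, Dot]]"

text \<open>Rows and columns are numbered from 1. For \<open>t \<ge> 1\<close>, row \<open>u\<^sub>k = 14 + 2 k\<close> is even and
  row \<open>v\<^sub>k = 15 + 2 k\<close> is odd.\<close>

definition K_row :: "nat \<Rightarrow> nat \<Rightarrow> label list" where
  "K_row t i =
    (if t = 0 then K0_rows ! (i - 1)
     else if i = 2 then (K0_rows ! 1)[0 := LA 0]
     else if i = 3 then (K0_rows ! 2)[0 := LS 0]
     else if i \<le> 15 then K0_rows ! (i - 1)
     else if i = 16 + 2 * t then [LB 9, LS t, LA t, Dot]
     else if even i then (let k = (i - 14) div 2 in [LA k, Dot, LA (k - 1), LR k])
     else (let k = (i - 15) div 2 in [LS k, LS (k - 1), Dot, LR k]))"

definition K_label :: "nat \<Rightarrow> cell \<Rightarrow> label" where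
  "K_label t c = K_row t (fst c) ! (snd c - 1)"

definition K_edge :: "nat \<Rightarrow> label \<Rightarrow> cell set" where
  "K_edge t x = {c \<in> grid (16 + 2 * t) 4. K_label t c = x}"

definition K :: "nat \<Rightarrow> config" where
  "K t = \<lparr>nrows = 16 + 2 * t, ncols = 4,
          one_edges = K_edge t Dot,
          two_edges = K_edge t ` (K_label t ` grid (16 + 2 * t) 4 - {Dot})\<rparr>"

end

theory Submission
  imports Defs
begin

text \<open>
  \<^bold>\<open>Extremality\<close> is a count. In a simple configuration the supports are disjoint, so
  \<open>|E\<^sub>1| + 2 |E\<^sub>2|\<close> is at most the number of cells. With four columns and \<open>m\<close> rows a
  \<open>C\<^sub>4\<close>-free set has at most \<open>m + 6\<close> cells: after the first cell of every row is set aside, a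
  remaining cell is determined by the pair consisting of its own column and the first column of its
  row, since a repeated pair would be a rectangle, and there are six pairs of columns. For
  \<open>m = 15 + 2t\<close> this leaves room for at most \<open>19 + 3t\<close> two-edges, hence for \<open>40 + 5t\<close> selected
  edges. The configuration of the theorem has a single hole and \<open>19 + 3t\<close> two-edges, so it attains
  both bounds, provided that it is admissible.

  \<^bold>\<open>Admissibility\<close> is the closure condition. Every rule that produces \<open>\<sim>\<close> starts from a linked
  pair or from \<open>\<sim>\<close> itself, so two cells of different selected edges are never equivalent, whatever
  the rules produce. It therefore suffices to certify every pair of occupied cells: \<open>\<sim>\<close> for two
  cells of one edge, \<open>\<bottom>\<close> for two cells of different edges. This is the predicate \<open>cert\<close>, and in
  terms of it the closure rules become short: aligned pairs are certified; the two diagonals of a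
  rectangle are certified together, and a diagonal through the hole counts as certified; the cells
  of an edge may be exchanged once the edge itself is certified.

  The certification has three stages. The two-edges come first. The hole starts the process, and the
  complementary pairs \<open>B\<^sub>1\<^sub>4, B\<^sub>1\<^sub>6\<close> and \<open>B\<^sub>1\<^sub>1, B\<^sub>1\<^sub>3\<close> feed it; the edges \<open>S\<^sub>i\<close> follow by
  increasing \<open>i\<close>, then \<open>B\<^sub>9\<close> through the last row, and after further seed edges the edges \<open>A\<^sub>i\<close> by
  decreasing \<open>i\<close>. Next, two cells of the chain rows \<open>u\<^sub>i, v\<^sub>i\<close> are compared. Two rectangles change an index
  pair \<open>(i, j)\<close> into \<open>(j, i)\<close> and \<open>(j + 1, i - 1)\<close>, so the two indices move towards each other
  until they meet in one row (\<open>exchange_induct\<close>). Finally the fourteen rows of the seed enter. Rectangles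
  within the seed certify all but 33 pairs of its edges. A partial statement about \<open>A\<^sub>i\<close> and \<open>S\<^sub>i\<close>
  against the seed is carried up the chain (\<open>step_up\<close>), improved in the last row (\<open>last_row\<close>),
  carried down again (\<open>step_down\<close>), and at the bottom of the chain it closes the open pairs of the
  seed (\<open>seed_complete\<close>). Rectangles between chain rows and seed rows then give everything else.
\<close>

section \<open>The configuration after the deletion\<close>

text \<open>Rows are numbered after the deletion: the seed occupies rows 1 to 14, and the last row is
\<open>u (t + 1)\<close>. Rows 2 and 3 get the index 0 because they carry \<open>A\<^sub>0\<close> and \<open>S\<^sub>0\<close> in
column 1, where \<open>u\<^sub>i\<close> and \<open>v\<^sub>i\<close> carry \<open>A\<^sub>i\<close> and \<open>S\<^sub>i\<close>; this makes the
statements about \<open>A\<^sub>i\<close> and \<open>S\<^sub>i\<close> uniform in \<open>i\<close>.\<close>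

definition u :: "nat \<Rightarrow> nat" where "u i = (if i = 0 then 2 else 13 + 2 * i)"

definition v :: "nat \<Rightarrow> nat" where "v i = (if i = 0 then 3 else 14 + 2 * i)"

text \<open>The cell \<open>(10, 1)\<close> keeps the otherwise unused label \<open>LB 17\<close>; it is the hole. For
\<open>t = 0\<close> the labels \<open>LA 0\<close> and \<open>LS 0\<close> stand for \<open>B\<^sub>2\<close> and \<open>B\<^sub>4\<close>, so that this case is not
an exception.\<close>

definition seed_rows :: "label list list" where
  "seed_rows =
    [[Dot, LB 1, Dot, LB 1],
     [LA 0, Dot, Dot, LB 3],
     [LS 0, LB 5, Dot, Dot],
     [Dot, Dot, LB 6, LB 7],
     [Dot, LB 9, LB 8, Dot],
     [LB 6, Dot, LB 10, Dot],
     [LB 12, Dot, LB 11, LB 13],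
     [LB 7, Dot, LB 13, LB 11],
     [LB 15, LB 16, LB 14, Dot],
     [LB 17, LB 14, LB 16, Dot],
     [LB 18, LB 10, LB 15, Dot],
     [LB 3, LB 8, LB 12, Dot],
     [LB 21, LB 21, LB 20, Dot],
     [LB 5, LB 20, LB 18, Dot]]"

definition row_labels :: "nat \<Rightarrow> nat \<Rightarrow> label list" where
  "row_labels t i =
    (if i \<le> 14 then seed_rows ! (i - 1)
     else if i = 15 + 2 * t then [LB 9, LS t, LA t, Dot]
     else if odd i then (let k = (i - 13) div 2 in [LA k, Dot, LA (k - 1), LR k])
     else (let k = (i - 14) div 2 in [LS k, LS (k - 1), Dot, LR k]))"

definition lab :: "nat \<Rightarrow> cell \<Rightarrow> label" where
  "lab t c = row_labels t (fst c) ! (snd c - 1)"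

definition occ :: "nat \<Rightarrow> cell set" where
  "occ t = grid (15 + 2 * t) 4 - {(10, 1)}"

text \<open>The row in which \<open>S\<^sub>i\<close> occurs for the second time, in column 2. For \<open>A\<^sub>i\<close> this is always
\<open>u (i + 1)\<close>, because the last row takes the role of \<open>u (t + 1)\<close>; a row \<open>v (t + 1)\<close> does not
exist.\<close>

definition v_next :: "nat \<Rightarrow> nat \<Rightarrow> nat" where
  "v_next t i = (if i = t then u (Suc t) else v (Suc i))"

definition seed_home :: "nat \<Rightarrow> cell set" where
  "seed_home b = the (map_of
    [(1, {(1, 2), (1, 4)}), (3, {(2, 4), (12, 1)}), (5, {(3, 2), (14, 1)}),
     (6, {(4, 3), (6, 1)}), (7, {(4, 4), (8, 1)}), (8, {(5, 3), (12, 2)}),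
     (10, {(6, 3), (11, 2)}), (11, {(7, 3), (8, 4)}), (12, {(7, 1), (12, 3)}),
     (13, {(7, 4), (8, 3)}), (14, {(9, 3), (10, 2)}), (15, {(9, 1), (11, 3)}),
     (16, {(9, 2), (10, 3)}), (18, {(11, 1), (14, 3)}), (20, {(13, 3), (14, 2)}),
     (21, {(13, 1), (13, 2)})] b)"

text \<open>The two cells of a two-edge, given explicitly. That they are the only cells with their label is
\<open>home_eq\<close>.\<close>

definition home :: "nat \<Rightarrow> label \<Rightarrow> cell set" where
  "home t x = (case x of
     Dot \<Rightarrow> {}
   | LB b \<Rightarrow> if b = 9 then {(5, 2), (u (Suc t), 1)} else seed_home b
   | LA i \<Rightarrow> {(u i, 1), (u (Suc i), 3)}
   | LS i \<Rightarrow> {(v i, 1), (v_next t i, 2)}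
   | LR i \<Rightarrow> {(u i, 4), (v i, 4)})"

definition pair_labels :: "nat \<Rightarrow> label set" where
  "pair_labels t = LB ` {1, 3, 5, 6, 7, 8, 9, 10, 11, 12, 13, 14, 15, 16, 18, 20, 21} \<union>
     LA ` {..t} \<union> LS ` {..t} \<union> LR ` {1..t}"

definition edge :: "nat \<Rightarrow> cell \<Rightarrow> cell set" where
  "edge t c = (if lab t c = Dot then {c} else home t (lab t c))"

lemma seed_lab: "i \<le> 14 \<Longrightarrow> lab t (i, j) = seed_rows ! (i - 1) ! (j - 1)"
  by (simp add: lab_def row_labels_def)

lemma lab_last: "lab t (u (Suc t), j) = [LB 9, LS t, LA t, Dot] ! (j - 1)"
  by (simp add: lab_def row_labels_def u_def)

lemma lab_u: "1 \<le> k \<Longrightarrow> k \<le> t \<Longrightarrow> lab t (u k, j) = [LA k, Dot,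
    LA (k - 1), LR k] ! (j - 1)"
  by (simp add: lab_def row_labels_def u_def)

lemma lab_v: "1 \<le> k \<Longrightarrow> k \<le> t \<Longrightarrow> lab t (v k, j) = [LS k,
    LS (k - 1), Dot, LR k] ! (j - 1)"
  by (simp add: lab_def row_labels_def v_def; presburger)

lemma row_cases:
  assumes "1 \<le> i" "i \<le> 15 + 2 * t"
  obtains "i \<in> {1, 2, 3, 4, 5, 6, 7, 8, 9, 10, 11, 12, 13, 14}"
    | k where "1 \<le> k" "k \<le> t" "i = u k"
    | k where "1 \<le> k" "k \<le> t" "i = v k"
    | "i = u (Suc t)"
proof -
  consider "i \<le> 14" | "i = 15 + 2 * t" | "15 \<le> i" "i < 15 + 2 * t" "odd i" | "15 \<le> i"
      "i < 15 + 2 * t" "even i"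
    using assms by linarith
  then show thesis
  proof cases
    case 1
    then have "i \<in> {1, 2, 3, 4, 5, 6, 7, 8, 9, 10, 11, 12, 13, 14}"
      using assms(1) by (simp add: numeral_eq_Suc le_Suc_eq)
    then show ?thesis by (rule that)
  next
    case 2
    then show ?thesis using that(4) by (simp add: u_def)
  next
    case 3
    then have "i = 13 + 2 * ((i - 13) div 2)" by presburger
    then obtain k where "i = 13 + 2 * k" by blast
    then show ?thesis using that(2)[of k] 3 by (simp add: u_def)
  next
    case 4
    then have "i = 14 + 2 * ((i - 14) div 2)" by presburger
    then obtain k where "i = 14 + 2 * k" by blast
    then show ?thesis using that(3)[of k] 4 by (simp add: v_def)
  qed
qed

lemma col_cases: "1 \<le> j \<Longrightarrow> j \<le> 4 \<Longrightarrow> j \<in> {1, 2, 3, 4::nat}"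
  by auto

lemma occ_cases:
  assumes "c \<in> occ t"
  obtains i j where "c = (i, j)" "i \<in> {1, 2, 3, 4, 5, 6, 7, 8, 9, 10, 11, 12, 13, 14}"
      "j \<in> {1, 2, 3, 4}"
     "c \<noteq> (10, 1)"
    | k j where "1 \<le> k" "k \<le> t" "j \<in> {1, 2, 3, 4}" "c = (u k, j)"
    | k j where "1 \<le> k" "k \<le> t" "j \<in> {1, 2, 3, 4}" "c = (v k, j)"
    | j where "c = (u (Suc t), j)" "j \<in> {1, 2, 3, 4}"
proof -
  obtain i j where c: "c = (i, j)" "1 \<le> i" "i \<le> 15 + 2 * t" and "1 \<le> j" "j \<le> 4"
      "c \<noteq> (10, 1)"
    using assms by (cases c) (auto simp: occ_def grid_def)
  then have j: "j \<in> {1, 2, 3, 4}" using col_cases by blast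
  show thesis
    using c(2,3)
  proof (cases rule: row_cases)
    case 1 then show ?thesis using that(1)[OF c(1)] j \<open>c \<noteq> (10, 1)\<close> by blast
  next
    case (2 k) then show ?thesis using that(2) j c(1) by blast
  next
    case (3 k) then show ?thesis using that(3) j c(1) by blast
  next
    case 4 then show ?thesis using that(4) j c(1) by blast
  qed
qed

lemma occ_home: "c \<in> occ t \<Longrightarrow> lab t c \<noteq> Dot
    \<Longrightarrow> lab t c \<in> pair_labels t \<and> c \<in> home t (lab t c)"
proof (erule occ_cases, goal_cases)
  case (1 i j)
  have "\<forall>i \<in> {1, 2, 3, 4, 5, 6, 7, 8, 9, 10, 11, 12, 13, 14}. \<forall>j \<in> {1, 2, 3, 4}.
      (i, j) \<noteq> (10, 1) \<longrightarrow> lab t (i, j) \<noteq> Dot \<longrightarrow>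
      lab t (i, j) \<in> pair_labels t \<and> (i, j) \<in> home t (lab t (i, j))"
    by (simp add: seed_lab seed_rows_def pair_labels_def home_def seed_home_def u_def v_def)
  with 1 show ?case by blast
next
  case (2 k j)
  then show ?case by (auto simp: lab_u pair_labels_def home_def)
next
  case (3 k j)
  then show ?case by (auto simp: lab_v pair_labels_def home_def v_next_def)
next
  case (4 j)
  then show ?case by (auto simp: lab_last pair_labels_def home_def v_next_def)
qed

lemma home_lab:
  assumes "x \<in> pair_labels t"
  shows "card (home t x) = 2" "home t x \<subseteq> {c \<in> occ t. lab t c = x}"
proof -
  have lab_u': "lab t (13 + 2 * k, j) = [LA k, Dot, LA (k - 1), LR k] ! (j - 1)" if "1 \<le> k"
      "k \<le> t" for k j
    using lab_u[OF that, of j] that by (simp add: u_def)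
  have *: "card (home t x) = 2 \<and> home t x \<subseteq> {c \<in> occ t. lab t c = x}"
    using assms unfolding pair_labels_def
  proof (elim UnE imageE, goal_cases)
    case (1 b)
    from 1(2) show ?case unfolding 1(1)
      by (elim insertE emptyE; hypsubst; simp add:
          home_def seed_home_def occ_def grid_def u_def seed_lab seed_rows_def
           lab_last[unfolded u_def, simplified])
  next
    case (2 i)
    have "lab t (u i, 1) = LA i" using 2 lab_u[of i t 1]
        by (cases "i = 0") (auto simp: u_def seed_lab seed_rows_def)
    moreover have "lab t (u (Suc i), 3) = LA i"
      using 2 lab_u[of "Suc i" t 3] lab_last[of t 3] by (cases "i = t") auto
    ultimately show ?case using 2 by (auto simp: home_def occ_def grid_def u_def)
  next
    case (3 i)
    have "lab t (v i, 1) = LS i" using 3 lab_v[of i t 1]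
        by (cases "i = 0") (auto simp: v_def seed_lab seed_rows_def)
    moreover have "lab t (v_next t i, 2) = LS i"
      using 3 lab_v[of "Suc i" t 2] lab_last[of t 2] by (cases "i = t") (auto simp: v_next_def)
    ultimately show ?case using 3 by (auto simp: home_def occ_def grid_def u_def v_def v_next_def)
  next
    case (4 i)
    then show ?case using lab_u[of i t 4] lab_v[of i t 4]
        by (auto simp: home_def occ_def grid_def u_def v_def)
  qed
  then show "card (home t x) = 2" "home t x \<subseteq> {c \<in> occ t. lab t c = x}" by auto
qed

lemma Dot_notin_pair_labels: "Dot \<notin> pair_labels t"
  by (auto simp: pair_labels_def)

lemma home_eq:
  assumes "x \<in> pair_labels t"
  shows "home t x = {c \<in> occ t. lab t c = x}"
proof
  show "{c \<in> occ t. lab t c = x} \<subseteq> home t x"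
  proof
    fix c assume c: "c \<in> {c \<in> occ t. lab t c = x}"
    moreover have "x \<noteq> Dot" using assms Dot_notin_pair_labels by metis
    ultimately show "c \<in> home t x" using occ_home[of c t] by simp
  qed
qed (rule home_lab(2)[OF assms])

text \<open>The configuration of the theorem in the coordinates of \<open>lab\<close>; the identification is
\<open>config_eq\<close>.\<close>

definition reduced :: "nat \<Rightarrow> config" where
  "reduced t = \<lparr>nrows = 15 + 2 * t, ncols = 4,
     one_edges = {c \<in> occ t. lab t c = Dot}, two_edges = home t ` pair_labels t\<rparr>"

lemma edge_iff:
  assumes "p \<in> occ t"
  shows "q \<in> edge t p \<longleftrightarrow> q \<in> occ t \<and> (q = p \<or> lab t q = lab t p
      \<and> lab t p \<noteq> Dot)"
proof (cases "lab t p = Dot")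
  case True
  then show ?thesis using assms by (auto simp: edge_def)
next
  case False
  then have "lab t p \<in> pair_labels t" using assms occ_home[of p t] by simp
  from home_eq[OF this] show ?thesis using assms False by (auto simp: edge_def)
qed

lemma edge_refl: "p \<in> occ t \<Longrightarrow> p \<in> edge t p"
  by (simp add: edge_iff)

lemma edge_in_occ: "p \<in> occ t \<Longrightarrow> q \<in> edge t p \<Longrightarrow> q \<in> occ t"
  by (simp add: edge_iff)

lemma edge_cong: "p \<in> occ t \<Longrightarrow> q \<in> edge t p \<Longrightarrow> edge t q = edge t p"
  by (metis edge_def edge_iff)

lemma edge_sym: "p \<in> occ t \<Longrightarrow> q \<in> edge t p \<Longrightarrow> p \<in> edge t q"
  by (auto simp: edge_iff)

lemma selected_reduced: "selected (reduced t) = edge t ` occ t"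
proof (intro equalityI subsetI)
  fix e assume "e \<in> selected (reduced t)"
  then consider c where "c \<in> occ t" "lab t c = Dot" "e = {c}" | x where "x \<in> pair_labels t"
      "e = home t x"
    by (auto simp: selected_def reduced_def)
  then show "e \<in> edge t ` occ t"
  proof cases
    case 1
    then show ?thesis by (force simp: edge_def)
  next
    case 2
    then have "home t x \<noteq> {}" using home_lab(1)[of x t] by auto
    then obtain c where c: "c \<in> home t x" by blast
    then have "c \<in> occ t" "lab t c = x" using home_eq 2 by auto
    moreover have "x \<noteq> Dot" using 2 Dot_notin_pair_labels by auto
    ultimately show ?thesis using 2 by (force simp: edge_def)
  qed
next
  fix e assume "e \<in> edge t ` occ t"
  then show "e \<in> selected (reduced t)"
    using occ_home by (fastforce simp: selected_def reduced_def edge_def)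
qed

lemma linked_reduced:
  assumes "p \<in> occ t" "q \<in> occ t"
  shows "linked (reduced t) p q \<longleftrightarrow> p \<noteq> q \<and> q \<in> edge t p"
proof
  assume "linked (reduced t) p q"
  then obtain x where x: "x \<in> pair_labels t" "home t x = {p, q}"
    by (auto simp: linked_def reduced_def)
  then have "p \<noteq> q" using home_lab(1)[OF x(1)] by auto
  moreover have "lab t p = x" using x home_lab(2)[OF x(1)] by auto
  ultimately show "p \<noteq> q \<and> q \<in> edge t p"
    using x Dot_notin_pair_labels by (auto simp: edge_def)
next
  assume *: "p \<noteq> q \<and> q \<in> edge t p"
  then have n: "lab t p \<noteq> Dot" by (auto simp: edge_def)
  then have x: "lab t p \<in> pair_labels t" "p \<in> home t (lab t p)" using occ_home assms by auto
  have "q \<in> home t (lab t p)" using * n by (simp add: edge_def)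
  then have "home t (lab t p) = {p, q}"
    using x home_lab(1)[OF x(1)] * by (auto simp: card_2_iff)
  then show "linked (reduced t) p q" using x(1) by (auto simp: linked_def reduced_def)
qed

lemma occupied_reduced: "occupied (reduced t) = occ t"
proof (intro equalityI subsetI)
  fix c assume "c \<in> occupied (reduced t)"
  then show "c \<in> occ t" using home_eq by (auto simp: occupied_def reduced_def)
next
  fix c assume "c \<in> occ t"
  then show "c \<in> occupied (reduced t)"
    using occ_home[of c t] by (cases "lab t c = Dot") (auto simp: occupied_def reduced_def)
qed

lemma holes_reduced: "holes (reduced t) = {(10, 1)}"
  unfolding holes_def occupied_reduced by (auto simp: occ_def cells_def reduced_def grid_def)

section \<open>Certified pairs of cells\<close>

text \<open>The pair is certified to have its prescribed value. Pairs with an unoccupied cell count as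
certified, which is how the rectangle rule treats a companion diagonal with a hole; it also
removes all range conditions from the rules below.\<close>

definition cert :: "nat \<Rightarrow> cell \<Rightarrow> cell \<Rightarrow> bool" where
  "cert t p q \<longleftrightarrow> (p \<in> occ t \<longrightarrow> q \<in> occ t \<longrightarrow>
     (if q \<in> edge t p then sim (reduced t) p q else perp (reduced t) p q))"

lemma cert_sym: "cert t p q \<Longrightarrow> cert t q p"
  unfolding cert_def using edge_sym sim_sym perp_sym by metis

lemma cert_aligned:
  assumes "fst p = fst q \<or> snd p = snd q"
  shows "cert t p q"
  unfolding cert_def
proof (intro impI)
  assume pq: "p \<in> occ t" "q \<in> occ t"
  show "if q \<in> edge t p then sim (reduced t) p q else perp (reduced t) p q"
  proof (cases "p = q")
    case True
    then show ?thesis using pq edge_refl sim_refl[of p "reduced t"] by (simp add: occupied_reduced)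
  next
    case False
    then show ?thesis
      using line_sim[of p "reduced t" q] line_perp[of p "reduced t" q] pq assms
      by (auto simp: occupied_reduced linked_reduced)
  qed
qed

lemma cert_hole: "cert t (10, 1) q" "cert t p (10, 1)"
  by (auto simp: cert_def occ_def)

text \<open>Rectangle transfer no longer depends on which of the two diagonals are linked: either
diagonal certifies the other. The hypothesis is the companion diagonal.\<close>

lemma cert_rect:
  assumes "i \<noteq> k" "j \<noteq> l" and c: "cert t (i, l) (k, j)"
  shows "cert t (i, j) (k, l)"
  unfolding cert_def
proof (intro impI)
  assume pq: "(i, j) \<in> occ t" "(k, l) \<in> occ t"
  let ?G = "reduced t"
  have d: "diagonals ?G (i, j) (k, l) (i, l) (k, j)"
    unfolding diagonals_def using assms pq by (auto simp: reduced_def occ_def grid_def)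
  have cells: "(i, l) \<in> occ t \<or> (i, l) \<in> holes ?G" "(k, j) \<in> occ t \<or> (k,
      j) \<in> holes ?G"
    using pq by (auto simp: holes_reduced occ_def grid_def)
  have nl: "\<not> linked ?G (i, l) (k, j)" if "(i, l) \<in> holes ?G \<or> (k, j) \<in> holes ?G"
  proof
    assume "linked ?G (i, l) (k, j)"
    then obtain x where "x \<in> pair_labels t" "home t x = {(i, l), (k, j)}"
      by (auto simp: linked_def reduced_def)
    then have "(i, l) \<in> occ t" "(k, j) \<in> occ t" using home_eq[of x t] by auto
    then show False using that by (auto simp: holes_reduced occ_def)
  qed
  have "(\<not> linked ?G (i, l) (k, j) \<and> ((i, l) \<in> holes ?G \<or> (k, j) \<in> holes ?G
      \<or> perp ?G (i, l) (k, j))) \<or>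
     (linked ?G (i, l) (k, j) \<and> (i, l) \<in> occupied ?G \<and> (k, j) \<in> occupied ?G
         \<and> sim ?G (i, l) (k, j))"
    using cells nl c assms(1) by (auto simp: cert_def linked_reduced occupied_reduced split: if_splits)
  from transfer_perp[OF d this] transfer_sim[OF d this]
  show "if (k, l) \<in> edge t (i, j) then sim ?G (i, j) (k, l) else perp ?G (i, j) (k, l)"
    using pq assms(1) by (auto simp: linked_reduced occupied_reduced)
qed

lemma cert_complementary:
  assumes "i \<noteq> k" "j \<noteq> l" "(i, j) \<in> occ t" "(i, l) \<in> occ t"
    and "(k, l) \<in> edge t (i, j)" "(k, j) \<in> edge t (i, l)"
  shows "cert t (i, j) (k, l)"
proof -
  have o: "(k, l) \<in> occ t" "(k, j) \<in> occ t" using assms edge_in_occ by blast+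
  have "diagonals (reduced t) (i, j) (k, l) (i, l) (k, j)"
    unfolding diagonals_def using assms o by (auto simp: reduced_def occ_def grid_def)
  from complementary[OF this] show ?thesis
    using assms o by (auto simp: cert_def linked_reduced)
qed

text \<open>Saturation and transitivity together: a certified two-edge may be represented by either of
its cells.\<close>

lemma cert_tied:
  assumes "p \<in> occ t" "p' \<in> edge t p" "cert t p p'"
  shows "cert t p' q \<longleftrightarrow> cert t p q"
proof -
  have o: "p' \<in> occ t" and e: "edge t p' = edge t p"
    using assms edge_in_occ edge_cong by blast+
  have s: "sim (reduced t) p p'" using assms o by (simp add: cert_def)
  show ?thesis
  proof (cases "q \<in> occ t")
    case True
    then have "sim (reduced t) q q" using sim_refl occupied_reduced by blast
    with s have "perp (reduced t) p' q \<longleftrightarrow> perp (reduced t) p q"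
      using saturation sim_sym by metis
    moreover have "sim (reduced t) p' q \<longleftrightarrow> sim (reduced t) p q"
      using s sim_sym sim_trans by metis
    ultimately show ?thesis using e assms(1) o by (simp add: cert_def)
  qed (simp add: cert_def)
qed

section \<open>All two-edges are certified\<close>

text \<open>Column 1 has to stay a numeral, since the facts about individual cells are used as rewrite
rules.\<close>

declare One_nat_def [simp del]

lemma cert_swap: "cert t (i, l) (k, j) \<Longrightarrow> i \<noteq> k \<Longrightarrow> j \<noteq> l
    \<Longrightarrow> cert t (i, j) (k, l)"
  by (rule cert_rect)

lemma cert_home:
  assumes "x \<in> pair_labels t" "home t x = {a, b}" "cert t a b"
  shows "cert t b q \<longleftrightarrow> cert t a q" "cert t q b \<longleftrightarrow> cert t q a"
proof -
  have "x \<noteq> Dot" using assms(1) Dot_notin_pair_labels by metis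
  moreover have "a \<in> home t x" "b \<in> home t x" using assms(2) by simp_all
  ultimately have *: "a \<in> occ t" "b \<in> edge t a"
    using home_eq[OF assms(1)] by (auto simp: edge_iff)
  show "cert t b q \<longleftrightarrow> cert t a q" by (rule cert_tied[OF * assms(3)])
  then show "cert t q b \<longleftrightarrow> cert t q a" using cert_sym by blast
qed

lemma LB_pair_labels: "b \<in> {1, 3, 5, 6, 7, 8, 9, 10, 11, 12, 13, 14, 15, 16, 18, 20, 21}
    \<Longrightarrow> LB b \<in> pair_labels t"
  by (auto simp: pair_labels_def)

lemma home_LB:
  "home t (LB 1) = {(1, 2), (1, 4)}" "home t (LB 3) = {(2, 4), (12, 1)}"
  "home t (LB 5) = {(3, 2), (14, 1)}" "home t (LB 6) = {(4, 3), (6, 1)}"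
  "home t (LB 7) = {(4, 4), (8, 1)}" "home t (LB 8) = {(5, 3), (12, 2)}"
  "home t (LB 9) = {(5, 2), (u (Suc t), 1)}"
  "home t (LB 10) = {(6, 3), (11, 2)}" "home t (LB 11) = {(7, 3), (8, 4)}"
  "home t (LB 12) = {(7, 1), (12, 3)}" "home t (LB 13) = {(7, 4), (8, 3)}"
  "home t (LB 14) = {(9, 3), (10, 2)}" "home t (LB 15) = {(9, 1), (11, 3)}"
  "home t (LB 16) = {(9, 2), (10, 3)}" "home t (LB 18) = {(11, 1), (14, 3)}"
  "home t (LB 20) = {(13, 3), (14, 2)}" "home t (LB 21) = {(13, 1), (13, 2)}"
  by (simp_all add: home_def seed_home_def)

lemma home_A: "home t (LA i) = {(u i, 1), (u (Suc i), 3)}"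
  and home_S: "home t (LS i) = {(v i, 1), (v_next t i, 2)}"
  and home_R: "home t (LR i) = {(u i, 4), (v i, 4)}"
  by (simp_all add: home_def)

lemma cert_row: "cert t (i, j) (i, l)" and cert_col: "cert t (i, j) (k, j)"
  by (rule cert_aligned, simp)+

lemma tied_complementary:
  "cert t (7, 3) (8, 4)" "cert t (7, 4) (8, 3)" "cert t (9, 3) (10, 2)" "cert t (9, 2) (10, 3)"
proof -
  have *: "(7, 3) \<in> occ t" "(7, 4) \<in> occ t" "(9, 3) \<in> occ t" "(9, 2) \<in> occ t"
    by (simp_all add: occ_def grid_def)
  have "(8, 4) \<in> edge t (7, 3)" "(8, 3) \<in> edge t (7, 4)" "(10, 2) \<in> edge t (9, 3)" "(10,
      3) \<in> edge t (9, 2)"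
    by (simp_all add: edge_def seed_lab seed_rows_def home_LB)
  with * show "cert t (7, 3) (8, 4)" "cert t (7, 4) (8, 3)" "cert t (9, 3) (10, 2)" "cert t (9, 2) (10, 3)"
    by (auto intro!: cert_complementary)
qed

text \<open>The pair \<open>B\<^sub>1\<^sub>4\<close>, \<open>B\<^sub>1\<^sub>8\<close> has a rectangle through the hole, and this certifies
\<open>B\<^sub>1\<^sub>5\<close>; the other edges follow in the order in which they are proved.\<close>

lemma tied_seed_1:
  "cert t (9, 1) (11, 3)" "cert t (11, 1) (14, 3)" "cert t (13, 3) (14, 2)" "cert t (6, 3) (11, 2)"
  "cert t (3, 2) (14, 1)" "cert t (4, 3) (6, 1)"
proof -
  note n = LB_pair_labels[of _ t]
  note b14 = cert_home[OF n home_LB(12) tied_complementary(3), simplified]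
  note b16 = cert_home[OF n home_LB(14) tied_complementary(4), simplified]
  note b21 = cert_home[OF n home_LB(17) cert_row, simplified]
  show a: "cert t (9, 1) (11, 3)"
  proof (rule cert_rect)
    have "cert t (10, 2) (11, 1)" by (rule cert_rect) (simp_all add: cert_hole)
    then show "cert t (9, 3) (11, 1)" by (simp add: b14)
  qed simp_all
  note b15 = cert_home[OF n home_LB(13) a, simplified]
  show b: "cert t (11, 1) (14, 3)"
  proof (rule cert_rect)
    show "cert t (11, 3) (14, 1)" by (simp add: b15 cert_col)
  qed simp_all
  note b18 = cert_home[OF n home_LB(15) b, simplified]
  show c: "cert t (13, 3) (14, 2)"
  proof (rule cert_rect)
    have "cert t (13, 1) (14, 3)" by (simp add: b18 cert_col)
    then show "cert t (13, 2) (14, 3)" by (simp add: b21)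
  qed simp_all
  note b20 = cert_home[OF n home_LB(16) c, simplified]
  show d: "cert t (6, 3) (11, 2)"
  proof (rule cert_rect)
    have "cert t (6, 1) (10, 3)" by (rule cert_rect) (simp_all add: cert_hole)
    then have "cert t (6, 1) (9, 2)" by (simp add: b16)
    then have "cert t (6, 2) (9, 1)" by (rule cert_swap) simp_all
    then show "cert t (6, 2) (11, 3)" by (simp add: b15)
  qed simp_all
  note b10 = cert_home[OF n home_LB(8) d, simplified]
  show "cert t (3, 2) (14, 1)"
  proof (rule cert_rect)
    have "cert t (3, 2) (14, 2)" by (rule cert_col)
    then have "cert t (3, 2) (13, 3)" by (simp add: b20)
    then have "cert t (3, 3) (13, 2)" by (rule cert_swap) simp_all
    then have "cert t (3, 3) (13, 1)" by (simp add: b21)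
    then have "cert t (3, 1) (13, 3)" by (rule cert_swap) simp_all
    then show "cert t (3, 1) (14, 2)" by (simp add: b20)
  qed simp_all
  show "cert t (4, 3) (6, 1)"
  proof (rule cert_rect)
    have "cert t (4, 3) (14, 2)" by (simp add: b20 cert_col)
    then have "cert t (4, 2) (14, 3)" by (rule cert_swap) simp_all
    then have "cert t (4, 2) (11, 1)" by (simp add: b18)
    then have "cert t (4, 1) (11, 2)" by (rule cert_swap) simp_all
    then show "cert t (4, 1) (6, 3)" by (simp add: b10)
  qed simp_all
qed

lemma u_inj [simp]: "u i = u k \<longleftrightarrow> i = k"
  by (auto simp: u_def)

lemma v_inj [simp]: "v i = v k \<longleftrightarrow> i = k"
  by (auto simp: v_def)

lemma u_neq_v [simp]: "u i \<noteq> v k" "v k \<noteq> u i"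
  by (auto simp: u_def v_def; presburger)+

lemma v_next_neq: "i \<le> t \<Longrightarrow> v_next t i \<noteq> v i"
  by (auto simp: v_next_def)

text \<open>The rectangle of \<open>S\<^sub>i\<close> has the companion \<open>S\<^sub>i\<^sub>-\<^sub>1\<close>, \<open>S\<^sub>i\<^sub>+\<^sub>1\<close> (at the ends \<open>B\<^sub>5\<close> and
\<open>B\<^sub>9\<close>). Once the lower edge is certified, its cell in column 1 can be used, and it is aligned with
the upper edge. So the induction goes upwards from \<open>B\<^sub>5\<close>.\<close>

lemma tied_S: "i \<le> t \<Longrightarrow> cert t (v i, 1) (v_next t i, 2)"
proof (induction i)
  case 0
  have "cert t (14, 1) (v_next t 0, 1)" by (rule cert_col)
  then have "cert t (v 0, 2) (v_next t 0, 1)"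
    using cert_home(1)[OF LB_pair_labels home_LB(3) tied_seed_1(5)] by (simp add: v_def)
  then show ?case by (rule cert_swap) (use v_next_neq[of 0 t] in simp_all)
next
  case (Suc i)
  have "v_next t i = v (Suc i)" using Suc.prems by (simp add: v_next_def)
  then have "cert t (v (Suc i), 2) (v_next t (Suc i), 1)"
    using cert_home(1)[OF _ home_S Suc.IH] Suc.prems by (simp add: pair_labels_def cert_col)
  then show ?case by (rule cert_swap) (use v_next_neq[OF Suc.prems] in simp_all)
qed

lemma tied_seed_2:
  "cert t (5, 2) (u (Suc t), 1)" "cert t (4, 4) (8, 1)" "cert t (7, 1) (12, 3)" "cert t (5, 3) (12, 2)"
proof -
  note n = LB_pair_labels[of _ t]
  note b6 = cert_home[OF n home_LB(4) tied_seed_1(6), simplified]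
  note b11 = cert_home[OF n home_LB(9) tied_complementary(1), simplified]
  have w: "u (Suc t) \<noteq> 5" by (simp add: u_def)
  show a: "cert t (5, 2) (u (Suc t), 1)"
  proof (rule cert_rect)
    have "cert t (5, 1) (v_next t t, 2)"
      using cert_home(2)[OF _ home_S tied_S, of t t "(5, 1)"] by (simp add: pair_labels_def cert_col)
    then show "cert t (5, 1) (u (Suc t), 2)" by (simp add: v_next_def)
  qed (use w in simp_all)
  note b9 = cert_home[OF n home_LB(7) a, simplified]
  show b: "cert t (4, 4) (8, 1)"
  proof (rule cert_rect)
    have "cert t (6, 1) (7, 1)" by (rule cert_col)
    then have "cert t (4, 3) (7, 1)" by (simp add: b6)
    then have "cert t (4, 1) (7, 3)" by (rule cert_swap) simp_all
    then show "cert t (4, 1) (8, 4)" by (simp add: b11)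
  qed simp_all
  note b7 = cert_home[OF n home_LB(5) b, simplified]
  show c: "cert t (7, 1) (12, 3)"
  proof (rule cert_rect)
    have "cert t (8, 1) (12, 4)" by (simp add: b7 cert_col)
    then have "cert t (8, 4) (12, 1)" by (rule cert_swap) simp_all
    then show "cert t (7, 3) (12, 1)" by (simp add: b11)
  qed simp_all
  note b12 = cert_home[OF n home_LB(10) c, simplified]
  show "cert t (5, 3) (12, 2)"
  proof (rule cert_rect)
    have "cert t (u (Suc t), 1) (12, 3)" by (simp only: b12 cert_col)
    then show "cert t (5, 2) (12, 3)" by (simp add: b9)
  qed simp_all
qed

text \<open>As for \<open>S\<^sub>i\<close>, but with column 3 and from above: the start is the companion of \<open>A\<^sub>t\<close>, which
meets \<open>B\<^sub>9\<close> in the last row.\<close>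

lemma tied_A: "i \<le> t \<Longrightarrow> cert t (u i, 1) (u (Suc i), 3)"
proof (induction i rule: inc_induct)
  case base
  note n = LB_pair_labels[of _ t]
  have "cert t (12, 2) (u t, 2)" by (rule cert_col)
  then have "cert t (5, 3) (u t, 2)"
    by (simp add: cert_home(1)[OF n home_LB(6) tied_seed_2(4)])
  then have "cert t (5, 2) (u t, 3)" by (rule cert_swap) (simp_all add: u_def)
  then have "cert t (u (Suc t), 1) (u t, 3)"
    by (simp add: cert_home(1)[OF n home_LB(7) tied_seed_2(1)])
  then have "cert t (u t, 3) (u (Suc t), 1)" by (rule cert_sym)
  then show ?case by (rule cert_swap) simp_all
next
  case (step i)
  have "cert t (u i, 3) (u (Suc (Suc i)), 3)" by (rule cert_col)
  then have "cert t (u i, 3) (u (Suc i), 1)"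
    using cert_home(2)[OF _ home_A step.IH] step.hyps by (simp add: pair_labels_def)
  then show ?case by (rule cert_swap) simp_all
qed

text \<open>The second cell of \<open>A\<^sub>0\<close> lies in the first row after the seed, which is the last row if
\<open>t = 0\<close>. There the column 1 cell belongs to \<open>B\<^sub>9\<close> instead of \<open>A\<^sub>1\<close>; this is the only difference
between the two cases.\<close>

lemma tied_B3: "cert t (2, 4) (12, 1)"
proof (rule cert_rect)
  note n = LB_pair_labels[of _ t]
  have "cert t (u 1, 1) (8, 3)"
  proof (cases t)
    case 0
    have "cert t (12, 2) (8, 2)" by (rule cert_col)
    then have "cert t (5, 3) (8, 2)"
      by (simp add: cert_home(1)[OF n home_LB(6) tied_seed_2(4)])
    then have "cert t (5, 2) (8, 3)" by (rule cert_swap) simp_all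
    then have "cert t (u (Suc t), 1) (8, 3)"
      by (simp add: cert_home(1)[OF n home_LB(7) tied_seed_2(1)])
    then show ?thesis using 0 by (simp add: One_nat_def)
  next
    case (Suc s)
    have "cert t (u (Suc 1), 3) (8, 3)" by (rule cert_col)
    then show ?thesis
      using cert_home(1)[OF _ home_A tied_A, of 1 t "(8, 3)"] Suc by (simp add: pair_labels_def)
  qed
  then have "cert t (u 1, 1) (7, 4)"
    by (simp add: cert_home(2)[OF n home_LB(11) tied_complementary(2)])
  then have "cert t (u 1, 4) (7, 1)" by (rule cert_swap) (simp_all add: u_def)
  then have "cert t (u 1, 4) (12, 3)"
    by (simp add: cert_home(2)[OF n home_LB(10) tied_seed_2(3)])
  then have "cert t (u 1, 3) (12, 4)" by (rule cert_swap) (simp_all add: u_def)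
  then have "cert t (u 0, 1) (12, 4)"
    using cert_home(1)[OF _ home_A tied_A, of 0 t "(12, 4)"] by (simp add: pair_labels_def One_nat_def)
  then show "cert t (2, 1) (12, 4)" by (simp add: u_def)
qed simp_all

lemma cert_within_edge:
  assumes "p \<in> occ t" "q \<in> edge t p"
  shows "cert t p q"
proof (cases "lab t p = Dot")
  case True
  then show ?thesis using assms(2) by (simp add: edge_def cert_aligned)
next
  case False
  have pair: "\<forall>p \<in> home t x. \<forall>q \<in> home t x. cert t p q" if "home t x = {a,
      b}" "cert t a b" for x a b
    using that cert_sym[OF that(2)] cert_aligned[of a a t] cert_aligned[of b b t] by simp
  have seed: "\<forall>b \<in> {1, 3, 5, 6, 7, 8, 9, 10, 11, 12, 13, 14, 15, 16, 18, 20, 21}.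
      \<forall>p \<in> home t (LB b). \<forall>q \<in> home t (LB b). cert t p q"
    unfolding ball_simps
    by (intro conjI TrueI home_LB[THEN pair] tied_complementary tied_seed_1 tied_seed_2 tied_B3 cert_row)
  have "lab t p \<in> pair_labels t" using occ_home[of p t] assms False by simp
  then have "\<forall>p' \<in> home t (lab t p). \<forall>q' \<in> home t (lab t p). cert t p' q'"
    unfolding pair_labels_def
  proof (elim UnE imageE, goal_cases)
    case (1 b)
    then show ?case using bspec[OF seed 1(2)] by (simp only: 1(1))
  next
    case (2 i)
    then show ?case using pair[OF home_A tied_A, of i] by simp
  next
    case (3 i)
    then show ?case using pair[OF home_S tied_S, of i] by simp
  next
    case (4 i)
    then show ?case using pair[OF home_R cert_col, of i] by simp
  qed
  then show ?thesis
    using occ_home[of p t] assms False by (simp add: edge_def)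
qed

section \<open>The seed on its own\<close>

lemma cert_move:
  assumes "p \<in> occ t" "p' \<in> edge t p"
  shows "cert t p' q \<longleftrightarrow> cert t p q" "cert t q p' \<longleftrightarrow> cert t q p"
proof -
  show "cert t p' q \<longleftrightarrow> cert t p q"
      by (rule cert_tied[OF assms cert_within_edge[OF assms]])
  then show "cert t q p' \<longleftrightarrow> cert t q p" using cert_sym by blast
qed

text \<open>With all two-edges certified, aligned cells in the two supports are enough.\<close>

lemma cert_near:
  assumes "\<exists>a \<in> edge t p. \<exists>b \<in> edge t q. fst a = fst b \<or> snd a = snd b"
  shows "cert t p q"
proof (cases "p \<in> occ t \<and> q \<in> occ t")
  case True
  from assms obtain a b where "a \<in> edge t p" "b \<in> edge t q" "cert t a b" using cert_aligned by blast
  then show ?thesis using cert_move True by blast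
qed (auto simp: cert_def)

lemma seed_occ: "i \<in> {1..14} \<Longrightarrow> j \<in> {1..4} \<Longrightarrow> i \<noteq> 10
    \<or> j \<noteq> 1 \<Longrightarrow> (i, j) \<in> occ t"
  by (auto simp: occ_def grid_def)

lemma seed_edge:
  "edge t (1, 1) = {(1, 1)}" "edge t (1, 2) = {(1, 2), (1, 4)}"
  "edge t (1, 3) = {(1, 3)}" "edge t (2, 1) = {(2, 1), (u 1, 3)}"
  "edge t (2, 2) = {(2, 2)}" "edge t (2, 3) = {(2, 3)}"
  "edge t (2, 4) = {(2, 4), (12, 1)}" "edge t (3, 1) = {(3, 1), (v_next t 0, 2)}"
  "edge t (3, 2) = {(3, 2), (14, 1)}" "edge t (3, 3) = {(3, 3)}"
  "edge t (3, 4) = {(3, 4)}" "edge t (4, 1) = {(4, 1)}" "edge t (4, 2) = {(4, 2)}"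
  "edge t (4, 3) = {(4, 3), (6, 1)}" "edge t (4, 4) = {(4, 4), (8, 1)}"
  "edge t (5, 1) = {(5, 1)}" "edge t (5, 2) = {(5, 2), (u (Suc t), 1)}"
  "edge t (5, 3) = {(5, 3), (12, 2)}" "edge t (5, 4) = {(5, 4)}"
  "edge t (6, 2) = {(6, 2)}" "edge t (6, 3) = {(6, 3), (11, 2)}"
  "edge t (6, 4) = {(6, 4)}" "edge t (7, 1) = {(7, 1), (12, 3)}"
  "edge t (7, 2) = {(7, 2)}" "edge t (7, 3) = {(7, 3), (8, 4)}"
  "edge t (7, 4) = {(7, 4), (8, 3)}" "edge t (8, 2) = {(8, 2)}"
  "edge t (9, 1) = {(9, 1), (11, 3)}" "edge t (9, 2) = {(9, 2), (10, 3)}"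
  "edge t (9, 3) = {(9, 3), (10, 2)}" "edge t (9, 4) = {(9, 4)}"
  "edge t (10, 4) = {(10, 4)}" "edge t (11, 1) = {(11, 1), (14, 3)}"
  "edge t (11, 4) = {(11, 4)}" "edge t (12, 4) = {(12, 4)}"
  "edge t (13, 1) = {(13, 1), (13, 2)}" "edge t (13, 3) = {(13, 3), (14, 2)}"
  "edge t (13, 4) = {(13, 4)}" "edge t (14, 4) = {(14, 4)}"
  by (simp_all add: edge_def seed_lab seed_rows_def home_LB home_A home_S)
    (simp_all add: u_def v_def One_nat_def)

text \<open>Rewriting to one representative per edge, so that a fact about an edge can be used at each
of its cells.\<close>

lemma seed_norm:
  "cert t (1, 4) q = cert t (1, 2) q" "cert t q (1, 4) = cert t q (1, 2)"
  "cert t (12, 1) q = cert t (2, 4) q" "cert t q (12, 1) = cert t q (2, 4)"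
  "cert t (14, 1) q = cert t (3, 2) q" "cert t q (14, 1) = cert t q (3, 2)"
  "cert t (6, 1) q = cert t (4, 3) q" "cert t q (6, 1) = cert t q (4, 3)"
  "cert t (8, 1) q = cert t (4, 4) q" "cert t q (8, 1) = cert t q (4, 4)"
  "cert t (12, 2) q = cert t (5, 3) q" "cert t q (12, 2) = cert t q (5, 3)"
  "cert t (11, 2) q = cert t (6, 3) q" "cert t q (11, 2) = cert t q (6, 3)"
  "cert t (12, 3) q = cert t (7, 1) q" "cert t q (12, 3) = cert t q (7, 1)"
  "cert t (8, 4) q = cert t (7, 3) q" "cert t q (8, 4) = cert t q (7, 3)"
  "cert t (8, 3) q = cert t (7, 4) q" "cert t q (8, 3) = cert t q (7, 4)"
  "cert t (11, 3) q = cert t (9, 1) q" "cert t q (11, 3) = cert t q (9, 1)"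
  "cert t (10, 3) q = cert t (9, 2) q" "cert t q (10, 3) = cert t q (9, 2)"
  "cert t (10, 2) q = cert t (9, 3) q" "cert t q (10, 2) = cert t q (9, 3)"
  "cert t (14, 3) q = cert t (11, 1) q" "cert t q (14, 3) = cert t q (11, 1)"
  "cert t (13, 2) q = cert t (13, 1) q" "cert t q (13, 2) = cert t q (13, 1)"
  "cert t (14, 2) q = cert t (13, 3) q" "cert t q (14, 2) = cert t q (13, 3)"
  "cert t (u (Suc t), 1) q = cert t (5, 2) q" "cert t q (u (Suc t), 1) = cert t q (5, 2)"
  by (rule cert_move; simp add: seed_occ seed_edge)+

text \<open>Each layer lists diagonals whose companions are aligned, run through the hole, or belong to an
earlier layer, up to exchanging cells of an edge. A fact names the cells of the rectangle that
yields it, so the companion of \<open>(i, j), (k, l)\<close> is read off as \<open>(i, l), (k, j)\<close>. The layers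
form a breadth-first search, which ends with the sixth.\<close>

lemma layer_1:
    "cert t (1, 4) (2, 1)" "cert t (1, 1) (2, 3)" "cert t (1, 1) (3, 4)" "cert t (1, 4) (4, 1)"
    "cert t (1, 1) (12, 2)" "cert t (1, 2) (5, 1)" "cert t (1, 2) (12, 3)"
    "cert t (1, 1) (6, 3)" "cert t (1, 1) (7, 3)" "cert t (1, 1) (8, 2)" "cert t (1, 1) (10, 3)"
    "cert t (1, 1) (9, 3)" "cert t (1, 2) (11, 3)" "cert t (1, 1) (10, 4)"
    "cert t (1, 2) (14, 3)" "cert t (1, 1) (12, 4)" "cert t (1, 1) (14, 2)"
    "cert t (1, 1) (13, 4)" "cert t (1, 1) (14, 4)" "cert t (1, 3) (12, 1)"
    "cert t (1, 3) (14, 1)" "cert t (1, 3) (4, 1)" "cert t (1, 3) (5, 2)" "cert t (1, 3) (5, 4)"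
    "cert t (1, 3) (6, 2)" "cert t (1, 3) (6, 4)" "cert t (1, 3) (7, 2)" "cert t (1, 3) (8, 2)"
    "cert t (1, 3) (9, 4)" "cert t (1, 3) (10, 4)" "cert t (1, 3) (13, 2)"
    "cert t (1, 3) (13, 4)" "cert t (2, 1) (3, 4)" "cert t (2, 1) (5, 4)" "cert t (2, 1) (6, 4)"
    "cert t (2, 2) (12, 3)" "cert t (4, 1) (5, 3)" "cert t (2, 1) (9, 4)"
    "cert t (2, 1) (10, 4)" "cert t (2, 1) (11, 4)" "cert t (2, 1) (12, 4)"
    "cert t (2, 1) (13, 4)" "cert t (2, 1) (14, 4)" "cert t (2, 3) (14, 1)"
    "cert t (2, 2) (3, 4)" "cert t (2, 2) (5, 1)" "cert t (2, 2) (5, 4)" "cert t (6, 2) (12, 1)"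
    "cert t (5, 4) (12, 3)" "cert t (7, 2) (12, 1)" "cert t (2, 2) (9, 1)"
    "cert t (9, 2) (12, 1)" "cert t (9, 3) (12, 1)" "cert t (2, 2) (11, 1)"
    "cert t (6, 3) (12, 1)" "cert t (2, 2) (12, 4)" "cert t (2, 2) (13, 4)"
    "cert t (12, 1) (13, 3)" "cert t (2, 3) (3, 1)" "cert t (3, 3) (12, 1)"
    "cert t (2, 3) (4, 1)" "cert t (2, 3) (4, 4)" "cert t (2, 3) (5, 1)" "cert t (2, 3) (5, 2)"
    "cert t (2, 3) (5, 4)" "cert t (2, 3) (6, 2)" "cert t (2, 3) (11, 4)"
    "cert t (2, 3) (12, 4)" "cert t (2, 3) (13, 1)" "cert t (2, 3) (14, 4)"
    "cert t (3, 1) (7, 3)" "cert t (3, 1) (10, 4)" "cert t (3, 1) (12, 4)"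
    "cert t (13, 2) (14, 4)" "cert t (3, 1) (14, 4)" "cert t (4, 3) (14, 4)"
    "cert t (7, 3) (14, 1)" "cert t (8, 3) (14, 1)" "cert t (11, 3) (14, 4)"
    "cert t (10, 4) (14, 1)" "cert t (11, 4) (14, 1)" "cert t (12, 4) (14, 1)"
    "cert t (3, 3) (4, 1)" "cert t (3, 3) (4, 2)" "cert t (3, 3) (5, 1)" "cert t (3, 3) (5, 2)"
    "cert t (3, 3) (6, 2)" "cert t (3, 3) (13, 1)" "cert t (3, 4) (14, 2)"
    "cert t (3, 4) (4, 1)" "cert t (3, 4) (4, 2)" "cert t (4, 1) (5, 4)" "cert t (4, 1) (6, 2)"
    "cert t (4, 1) (6, 3)" "cert t (4, 1) (6, 4)" "cert t (4, 2) (12, 3)" "cert t (4, 1) (7, 3)"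
    "cert t (4, 1) (7, 4)" "cert t (4, 1) (8, 2)" "cert t (4, 1) (10, 3)" "cert t (4, 1) (9, 3)"
    "cert t (4, 1) (9, 4)" "cert t (4, 1) (10, 4)" "cert t (4, 1) (11, 4)"
    "cert t (4, 1) (12, 4)" "cert t (4, 1) (13, 3)" "cert t (4, 1) (13, 4)"
    "cert t (4, 1) (14, 4)" "cert t (4, 2) (5, 1)" "cert t (4, 2) (5, 4)"
    "cert t (8, 2) (12, 3)" "cert t (4, 2) (8, 4)" "cert t (4, 2) (11, 3)"
    "cert t (8, 1) (10, 3)" "cert t (8, 1) (9, 3)" "cert t (4, 2) (14, 3)"
    "cert t (4, 4) (6, 3)" "cert t (4, 2) (13, 4)" "cert t (8, 1) (14, 2)"
    "cert t (6, 1) (10, 4)" "cert t (4, 3) (11, 4)" "cert t (4, 3) (12, 4)"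
    "cert t (5, 1) (6, 2)" "cert t (5, 1) (6, 3)" "cert t (5, 1) (7, 2)" "cert t (5, 1) (7, 3)"
    "cert t (5, 1) (8, 2)" "cert t (5, 1) (9, 2)" "cert t (5, 1) (9, 3)" "cert t (6, 4) (7, 1)"
    "cert t (5, 1) (10, 4)" "cert t (8, 3) (13, 2)" "cert t (5, 1) (12, 4)"
    "cert t (5, 1) (13, 3)" "cert t (5, 2) (7, 3)" "cert t (5, 2) (8, 3)" "cert t (7, 1) (9, 4)"
    "cert t (7, 1) (10, 4)" "cert t (5, 2) (12, 4)" "cert t (12, 4) (13, 1)"
    "cert t (6, 2) (12, 3)" "cert t (6, 2) (7, 3)" "cert t (6, 2) (8, 3)" "cert t (6, 2) (9, 1)"
    "cert t (9, 3) (11, 4)" "cert t (9, 1) (10, 4)" "cert t (6, 2) (11, 1)"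
    "cert t (6, 2) (11, 4)" "cert t (13, 4) (14, 3)" "cert t (6, 4) (11, 3)"
    "cert t (7, 1) (11, 4)" "cert t (7, 2) (9, 1)" "cert t (7, 2) (9, 4)"
    "cert t (7, 2) (10, 4)" "cert t (7, 2) (11, 1)" "cert t (7, 2) (11, 4)"
    "cert t (7, 2) (12, 4)" "cert t (7, 2) (14, 4)" "cert t (7, 3) (13, 1)"
    "cert t (8, 2) (11, 3)" "cert t (8, 2) (9, 4)" "cert t (8, 2) (10, 4)"
    "cert t (8, 2) (14, 3)" "cert t (8, 2) (11, 4)" "cert t (8, 2) (12, 4)"
    "cert t (8, 2) (14, 4)" "cert t (9, 1) (12, 4)" "cert t (9, 4) (11, 1)"
    "cert t (10, 4) (11, 1)" "cert t (10, 4) (13, 1)" "cert t (11, 1) (12, 4)"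
  by (rule cert_rect, simp, simp, simp add: cert_hole seed_norm seed_edge cert_near)+

lemmas known_1 = layer_1[unfolded seed_norm] layer_1[unfolded seed_norm, THEN cert_sym]

lemma layer_2:
    "cert t (1, 1) (2, 2)" "cert t (1, 1) (4, 2)" "cert t (1, 1) (5, 4)" "cert t (1, 1) (7, 4)"
    "cert t (1, 1) (7, 2)" "cert t (1, 1) (9, 4)" "cert t (1, 1) (11, 4)" "cert t (1, 4) (2, 3)"
    "cert t (1, 2) (3, 3)" "cert t (1, 3) (5, 1)" "cert t (1, 3) (11, 4)"
    "cert t (1, 3) (12, 4)" "cert t (1, 3) (14, 4)" "cert t (2, 1) (7, 2)"
    "cert t (4, 2) (12, 1)" "cert t (2, 2) (3, 3)" "cert t (2, 2) (6, 4)" "cert t (5, 1) (7, 4)"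
    "cert t (2, 2) (7, 4)" "cert t (2, 2) (9, 4)" "cert t (2, 2) (10, 4)"
    "cert t (2, 2) (11, 4)" "cert t (2, 2) (14, 4)" "cert t (2, 3) (3, 4)"
    "cert t (2, 3) (6, 4)" "cert t (2, 3) (9, 4)" "cert t (2, 3) (10, 4)"
    "cert t (2, 3) (13, 4)" "cert t (13, 4) (14, 1)" "cert t (6, 4) (14, 1)"
    "cert t (9, 4) (14, 1)" "cert t (3, 4) (12, 2)" "cert t (3, 4) (11, 2)"
    "cert t (3, 3) (7, 2)" "cert t (3, 3) (8, 2)" "cert t (3, 4) (10, 2)"
    "cert t (3, 3) (13, 4)" "cert t (3, 4) (7, 2)" "cert t (3, 4) (8, 2)" "cert t (4, 1) (7, 2)"
    "cert t (7, 2) (8, 1)" "cert t (4, 2) (9, 4)" "cert t (4, 2) (10, 4)"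
    "cert t (4, 2) (11, 4)" "cert t (4, 2) (14, 4)" "cert t (4, 3) (7, 2)"
    "cert t (4, 3) (9, 4)" "cert t (4, 3) (13, 4)" "cert t (6, 3) (12, 4)"
    "cert t (7, 1) (13, 4)" "cert t (9, 3) (12, 4)" "cert t (10, 3) (12, 4)"
    "cert t (12, 2) (13, 4)" "cert t (5, 4) (7, 2)" "cert t (5, 4) (8, 2)"
    "cert t (10, 4) (11, 2)" "cert t (10, 3) (11, 4)" "cert t (11, 4) (13, 1)"
    "cert t (6, 4) (11, 1)" "cert t (6, 4) (7, 2)" "cert t (6, 4) (8, 2)"
    "cert t (7, 1) (14, 4)" "cert t (7, 2) (13, 4)" "cert t (8, 2) (13, 4)"
    "cert t (9, 3) (14, 4)" "cert t (10, 3) (14, 4)" "cert t (10, 2) (13, 4)"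
  by (rule cert_rect, simp, simp, simp add: cert_hole seed_norm seed_edge cert_near known_1)+

lemmas known_2 = layer_2[unfolded seed_norm] layer_2[unfolded seed_norm, THEN cert_sym]

lemma layer_3:
    "cert t (1, 3) (8, 1)" "cert t (1, 3) (2, 2)" "cert t (1, 3) (3, 4)" "cert t (2, 2) (4, 4)"
    "cert t (5, 3) (8, 1)" "cert t (2, 3) (8, 2)" "cert t (3, 4) (13, 2)" "cert t (3, 3) (5, 4)"
    "cert t (3, 3) (6, 4)" "cert t (3, 3) (9, 4)" "cert t (3, 4) (9, 2)" "cert t (3, 4) (6, 2)"
    "cert t (4, 2) (7, 4)" "cert t (11, 4) (12, 2)" "cert t (12, 4) (13, 3)"
    "cert t (10, 4) (12, 2)" "cert t (9, 4) (12, 2)" "cert t (5, 4) (13, 3)"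
    "cert t (6, 4) (10, 3)" "cert t (9, 4) (11, 2)" "cert t (6, 4) (13, 1)"
    "cert t (11, 2) (13, 4)" "cert t (6, 3) (14, 4)" "cert t (10, 4) (14, 2)"
    "cert t (9, 4) (13, 3)"
  by (rule cert_rect, simp, simp, simp add: cert_hole seed_norm seed_edge cert_near known_1 known_2)+

lemmas known_3 = layer_3[unfolded seed_norm] layer_3[unfolded seed_norm, THEN cert_sym]

lemma layer_4:
    "cert t (1, 4) (4, 3)" "cert t (2, 1) (8, 2)" "cert t (8, 2) (12, 1)"
    "cert t (3, 1) (13, 4)" "cert t (3, 3) (10, 4)" "cert t (4, 3) (8, 2)"
    "cert t (4, 2) (12, 4)" "cert t (4, 3) (5, 4)" "cert t (5, 4) (11, 3)"
    "cert t (12, 2) (14, 4)" "cert t (5, 4) (10, 3)" "cert t (5, 4) (9, 3)"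
    "cert t (5, 2) (14, 4)" "cert t (6, 2) (9, 4)" "cert t (6, 4) (9, 3)"
    "cert t (6, 2) (13, 4)" "cert t (6, 4) (13, 3)" "cert t (11, 4) (14, 2)"
    "cert t (10, 3) (13, 4)"
  by (rule cert_rect, simp, simp, simp add:
      cert_hole seed_norm seed_edge cert_near known_1 known_2 known_3)+

lemmas known_4 = layer_4[unfolded seed_norm] layer_4[unfolded seed_norm, THEN cert_sym]

lemma layer_5:
    "cert t (1, 1) (6, 2)" "cert t (1, 1) (6, 4)" "cert t (1, 3) (4, 2)" "cert t (2, 2) (8, 4)"
    "cert t (6, 2) (8, 1)" "cert t (5, 1) (6, 4)" "cert t (5, 1) (9, 4)" "cert t (5, 4) (14, 3)"
    "cert t (5, 2) (9, 4)" "cert t (5, 2) (10, 4)" "cert t (6, 2) (10, 4)"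
    "cert t (6, 2) (14, 4)" "cert t (11, 3) (13, 4)" "cert t (9, 4) (13, 2)"
  by (rule cert_rect, simp, simp, simp add:
      cert_hole seed_norm seed_edge cert_near known_1 known_2 known_3 known_4)+

lemmas known_5 = layer_5[unfolded seed_norm] layer_5[unfolded seed_norm, THEN cert_sym]

lemma layer_6:
    "cert t (2, 3) (7, 2)" "cert t (4, 2) (6, 4)" "cert t (5, 1) (11, 4)"
  by (rule cert_rect, simp, simp, simp add:
      cert_hole seed_norm seed_edge cert_near known_1 known_2 known_3 known_4 known_5)+

lemmas known_6 = layer_6[unfolded seed_norm] layer_6[unfolded seed_norm, THEN cert_sym]

text \<open>One cell for every selected edge that meets the seed rows.\<close>

definition seed_cells :: "cell list" where
  "seed_cells = [
    (1, 1), (1, 2), (1, 3), (2, 1), (2, 2), (2, 3), (2, 4), (3, 1), (3, 2), (3, 3),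
    (3, 4), (4, 1), (4, 2), (4, 3), (4, 4), (5, 1), (5, 2), (5, 3), (5, 4), (6, 2),
    (6, 3), (6, 4), (7, 1), (7, 2), (7, 3), (7, 4), (8, 2), (9, 1), (9, 2), (9, 3),
    (9, 4), (10, 4), (11, 1), (11, 4), (12, 4), (13, 1), (13, 3), (13, 4), (14, 4)]"

text \<open>The pairs of edges that rectangles within the seed rows do not decide. They are settled in
\<open>seed_complete\<close> with the help of the chain.\<close>

definition open_pairs :: "(cell \<times> cell) list" where
  "open_pairs = [
    ((1, 1), (3, 3)), ((1, 3), (3, 1)), ((2, 1), (4, 2)), ((2, 1), (6, 2)),
    ((2, 2), (4, 1)), ((2, 2), (4, 3)), ((2, 3), (4, 2)), ((3, 1), (5, 4)),
    ((3, 1), (6, 4)), ((3, 1), (7, 4)), ((3, 1), (9, 4)), ((3, 1), (11, 4)),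
    ((3, 2), (5, 4)), ((3, 3), (4, 4)), ((3, 3), (11, 4)), ((3, 3), (12, 4)),
    ((3, 3), (14, 4)), ((3, 4), (4, 3)), ((3, 4), (5, 1)), ((3, 4), (5, 2)),
    ((3, 4), (7, 1)), ((3, 4), (9, 1)), ((3, 4), (11, 1)), ((5, 1), (13, 4)),
    ((5, 1), (14, 4)), ((5, 2), (6, 4)), ((5, 2), (11, 4)), ((5, 2), (13, 4)),
    ((5, 3), (6, 4)), ((5, 4), (6, 2)), ((5, 4), (6, 3)), ((5, 4), (13, 1)),
    ((6, 2), (12, 4))]"

lemma seed_known:
  "\<forall>p \<in> set seed_cells. \<forall>q \<in> set seed_cells.
     (p, q) \<in> set open_pairs \<or> (q, p) \<in> set open_pairs \<or> cert t p q"
  by (simp add: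
      seed_cells_def open_pairs_def cert_aligned seed_edge cert_near known_1 known_2 known_3 known_4 known_5 known_6)

section \<open>Pairs of chain cells\<close>

text \<open>Both moves preserve \<open>i + j\<close>. Below the diagonal a shift followed by a swap turns
\<open>(i, j)\<close> into \<open>(i - 1, j + 1)\<close> and decreases the gap by 2, until the indices agree or differ by 1;
above the diagonal one swap is enough.\<close>

lemma exchange_induct:
  fixes P :: "nat \<Rightarrow> nat \<Rightarrow> bool"
  assumes same: "\<And>i. 1 \<le> i \<Longrightarrow> i \<le> t \<Longrightarrow> P i i"
    and step: "\<And>i. Suc i \<le> t \<Longrightarrow> P (Suc i) i"
    and swap: "\<And>i j. 1 \<le> i \<Longrightarrow> i \<le> t \<Longrightarrow> 1 \<le> j
        \<Longrightarrow> j \<le> t \<Longrightarrow> i \<noteq> j \<Longrightarrow>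
       P j i \<Longrightarrow> P i j"
    and shift: "\<And>i j. Suc i \<le> t \<Longrightarrow> Suc j \<le> t
        \<Longrightarrow> i \<noteq> j \<Longrightarrow>
       P (Suc j) i \<Longrightarrow> P (Suc i) j"
    and "1 \<le> i" "i \<le> t" "j \<le> t"
  shows "P i j"
proof -
  have below: "P i j" if "j < i" "i \<le> t" for i j
    using that
  proof (induction "i - j" arbitrary: i j rule: less_induct)
    case less
    then obtain k where k: "i = Suc k" by (cases i) auto
    consider "j = k" | "Suc j = k" | "Suc j < k" using less.prems k by linarith
    then show ?case
    proof cases
      case 1
      then show ?thesis using step less.prems k by simp
    next
      case 2
      then show ?thesis using shift[of k j] same[of k] less.prems k by simp
    next
      case 3
      then have "P k (Suc j)" using less.hyps[of k "Suc j"] less.prems k by simp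
      then have "P (Suc j) k" using swap[of "Suc j" k] less.prems k 3 by simp
      then show ?thesis using shift[of k j] less.prems k 3 by simp
    qed
  qed
  show ?thesis
    using below[of j i] below[of i j] swap[of i j] same[of i] assms(5-7)
    by (cases i j rule: linorder_cases) auto
qed

context
  fixes t :: nat
begin

lemma A_occ: "i \<le> t \<Longrightarrow> (u i, 1) \<in> occ t"
  and S_occ: "i \<le> t \<Longrightarrow> (v i, 1) \<in> occ t"
  and U_occ: "1 \<le> i \<Longrightarrow> i \<le> t \<Longrightarrow> (u i, j) \<in> occ t
      \<longleftrightarrow> j \<in> {1..4}"
  by (auto simp: occ_def grid_def u_def v_def)

lemma A_edge: "i \<le> t \<Longrightarrow> edge t (u i, 1) = {(u i, 1), (u (Suc i), 3)}"
  using home_lab(2)[of "LA i" t] by (simp add: edge_def home_A pair_labels_def)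

lemma S_edge: "i \<le> t \<Longrightarrow> edge t (v i, 1) = {(v i, 1), (v_next t i, 2)}"
  using home_lab(2)[of "LS i" t] by (simp add: edge_def home_S pair_labels_def)

lemma R_edge: "1 \<le> i \<Longrightarrow> i \<le> t \<Longrightarrow> edge t (u i, 4) = {(u i, 4),
    (v i, 4)}"
  using home_lab(2)[of "LR i" t] by (simp add: edge_def home_R pair_labels_def)

lemma A_norm: "i \<le> t \<Longrightarrow> cert t (u (Suc i), 3) q \<longleftrightarrow> cert t (u i, 1) q"
    "i \<le> t \<Longrightarrow> cert t q (u (Suc i), 3) \<longleftrightarrow> cert t q (u i, 1)"
  by (rule cert_move; simp add: A_occ A_edge)+

lemma S_norm: "i < t \<Longrightarrow> cert t (v (Suc i), 2) q \<longleftrightarrow> cert t (v i, 1) q"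
    "i < t \<Longrightarrow> cert t q (v (Suc i), 2) \<longleftrightarrow> cert t q (v i, 1)"
    "cert t (u (Suc t), 2) q \<longleftrightarrow> cert t (v t, 1) q"
    "cert t q (u (Suc t), 2) \<longleftrightarrow> cert t q (v t, 1)"
  by (rule cert_move; simp add: S_occ S_edge v_next_def)+

lemma R_norm: "1 \<le> i \<Longrightarrow> i \<le> t \<Longrightarrow> cert t (v i, 4) q
    \<longleftrightarrow> cert t (u i, 4) q"
    "1 \<le> i \<Longrightarrow> i \<le> t \<Longrightarrow> cert t q (v i, 4)
        \<longleftrightarrow> cert t q (u i, 4)"
  by (rule cert_move; simp add: U_occ R_edge)+

text \<open>The names give the two edges: \<open>R\<^sub>i\<close>, \<open>S\<^sub>j\<close>, the dots \<open>U\<^sub>i\<close> and \<open>V\<^sub>i\<close>, the last dot \<open>W\<close>. A swap is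
the rectangle through the column 1 cell of \<open>S\<^sub>j\<close>, a shift the rectangle through its other
cell.\<close>

lemma R_S:
  assumes "1 \<le> i" "i \<le> t" "j \<le> t"
  shows "cert t (u i, 4) (v j, 1)"
proof (rule exchange_induct[where t = t and P = "\<lambda>i j. cert t (u i, 4) (v j, 1)"], goal_cases)
  case (1 i)
  then show ?case using cert_row[of t "v i" 4 1] by (simp add: R_norm)
next
  case (2 i)
  then show ?case using cert_row[of t "v (Suc i)" 4 2] by (simp add: R_norm S_norm)
next
  case (3 i j)
  then have "cert t (v i, 1) (v j, 4)" using cert_sym[OF 3(6)] by (simp add: R_norm)
  then have "cert t (v i, 4) (v j, 1)" by (rule cert_swap) (use 3 in simp_all)
  then show ?case using 3 by (simp add: R_norm)
next
  case (4 i j)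
  then have "cert t (v (Suc i), 2) (v (Suc j), 4)" using cert_sym[OF 4(4)] by (simp add: R_norm S_norm)
  then have "cert t (v (Suc i), 4) (v (Suc j), 2)" by (rule cert_swap) (use 4 in simp_all)
  then show ?case using 4 by (simp add: R_norm S_norm)
qed (use assms in auto)

lemma u_A:
  assumes "l = 2 \<or> l = 4" "1 \<le> i" "i \<le> t" "j \<le> t"
  shows "cert t (u i, l) (u j, 1)"
proof (rule exchange_induct[where t = t and P = "\<lambda>i j. cert t (u i, l) (u j, 1)"], goal_cases)
  case (1 i)
  show ?case by (rule cert_row)
next
  case (2 i)
  then show ?case using cert_row[of t "u (Suc i)" l 3] by (simp add: A_norm)
next
  case (3 i j)
  show ?case by (rule cert_swap[OF cert_sym[OF 3(6)]]) (use 3 assms(1) in auto)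
next
  case (4 i j)
  then have "cert t (u (Suc i), 3) (u (Suc j), l)" using cert_sym[OF 4(4)] by (simp add: A_norm)
  then have "cert t (u (Suc i), l) (u (Suc j), 3)" by (rule cert_swap) (use 4 assms(1) in auto)
  then show ?case using 4 by (simp add: A_norm)
qed (use assms in auto)

lemmas U_A = u_A[of 2, OF disjI1[OF refl]] and R_A = u_A[of 4, OF disjI2[OF refl]]

lemma V_S:
  assumes "1 \<le> i" "i \<le> t" "j \<le> t"
  shows "cert t (v i, 3) (v j, 1)"
proof (rule exchange_induct[where t = t and P = "\<lambda>i j. cert t (v i, 3) (v j, 1)"], goal_cases)
  case (1 i)
  show ?case by (rule cert_row)
next
  case (2 i)
  then show ?case using cert_row[of t "v (Suc i)" 3 2] by (simp add: S_norm)
next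
  case (3 i j)
  show ?case by (rule cert_swap[OF cert_sym[OF 3(6)]]) (use 3 in auto)
next
  case (4 i j)
  then have "cert t (v (Suc i), 2) (v (Suc j), 3)" using cert_sym[OF 4(4)] by (simp add: S_norm)
  then have "cert t (v (Suc i), 3) (v (Suc j), 2)" by (rule cert_swap) (use 4 in simp_all)
  then show ?case using 4 by (simp add: S_norm)
qed (use assms in auto)

lemma A_V: "1 \<le> j \<Longrightarrow> j \<le> t \<Longrightarrow> i \<le> t
    \<Longrightarrow> cert t (v j, 3) (u i, 1)"
  using cert_col[of t "v j" 3 "u (Suc i)"] by (simp add: A_norm)

lemma S_U: "1 \<le> j \<Longrightarrow> j \<le> t \<Longrightarrow> i \<le> t
    \<Longrightarrow> cert t (u j, 2) (v i, 1)"
proof (rule cert_near)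
  assume *: "1 \<le> j" "j \<le> t" "i \<le> t"
  then have "edge t (u j, 2) = {(u j, 2)}" by (simp add: edge_def lab_u)
  then show "\<exists>a \<in> edge t (u j, 2). \<exists>b \<in> edge t (v i, 1). fst a = fst b
      \<or> snd a = snd b"
    using * by (simp add: S_edge)
qed

text \<open>For the remaining kinds of pairs one rectangle leads to an aligned pair or to one of the
four families above.\<close>

lemma U_V: "1 \<le> i \<Longrightarrow> i \<le> t \<Longrightarrow> 1 \<le> j
    \<Longrightarrow> j \<le> t \<Longrightarrow> cert t (u i, 2) (v j, 3)"
proof (rule cert_rect)
  assume *: "1 \<le> i" "i \<le> t" "1 \<le> j" "j \<le> t"
  then obtain i' j' where "i = Suc i'" "j = Suc j'" by (cases i; cases j) auto
  then show "cert t (u i, 3) (v j, 2)" using * by (simp add: A_norm S_norm cert_col)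
qed simp_all

lemma U_R: "1 \<le> i \<Longrightarrow> i \<le> t \<Longrightarrow> 1 \<le> j
    \<Longrightarrow> j \<le> t \<Longrightarrow> cert t (u i, 2) (u j, 4)"
proof -
  assume *: "1 \<le> i" "i \<le> t" "1 \<le> j" "j \<le> t"
  then obtain j' where "j = Suc j'" by (cases j) auto
  then have "cert t (u i, 4) (v j, 2)" using * by (simp add: S_norm R_S)
  then have "cert t (u i, 2) (v j, 4)" by (rule cert_swap) simp_all
  then show "cert t (u i, 2) (u j, 4)" using * by (simp add: R_norm)
qed

lemma V_R: "1 \<le> i \<Longrightarrow> i \<le> t \<Longrightarrow> 1 \<le> j
    \<Longrightarrow> j \<le> t \<Longrightarrow> cert t (v i, 3) (u j, 4)"
proof (rule cert_rect)
  assume *: "1 \<le> i" "i \<le> t" "1 \<le> j" "j \<le> t"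
  then obtain j' where "j = Suc j'" by (cases j) auto
  then show "cert t (v i, 4) (u j, 3)" using * by (simp add: A_norm R_norm R_A)
qed simp_all

lemma W_A: "i \<le> t \<Longrightarrow> cert t (u (Suc t), 4) (u i, 1)"
proof (cases "i = t")
  case True
  then show ?thesis using cert_row[of t "u (Suc t)" 4 3] by (simp add: A_norm)
next
  case False
  moreover assume "i \<le> t"
  ultimately have "cert t (u (Suc t), 3) (u (Suc i), 4)"
    using cert_sym[OF R_A[of "Suc i" t]] by (simp add: A_norm)
  then have "cert t (u (Suc t), 4) (u (Suc i), 3)" by (rule cert_swap) (use False in simp_all)
  then show ?thesis using \<open>i \<le> t\<close> by (simp add: A_norm)
qed

lemma W_S: "i \<le> t \<Longrightarrow> cert t (u (Suc t), 4) (v i, 1)"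
proof (cases "i = t")
  case True
  then show ?thesis using cert_row[of t "u (Suc t)" 4 2] by (simp add: S_norm)
next
  case False
  moreover assume "i \<le> t"
  ultimately have "cert t (u (Suc t), 2) (v (Suc i), 4)"
    using cert_sym[OF R_S[of "Suc i" t]] by (simp add: S_norm R_norm)
  then have "cert t (u (Suc t), 4) (v (Suc i), 2)" by (rule cert_swap) simp_all
  then show ?thesis using \<open>i \<le> t\<close> False by (simp add: S_norm)
qed

lemma W_U: "1 \<le> i \<Longrightarrow> i \<le> t \<Longrightarrow> cert t (u (Suc t), 4) (u i, 2)"
  by (rule cert_rect) (use cert_sym[OF R_S[of i t]] in \<open>simp_all add: S_norm\<close>)

lemma W_V: "1 \<le> i \<Longrightarrow> i \<le> t \<Longrightarrow> cert t (u (Suc t), 4) (v i, 3)"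
  by (rule cert_rect) (use cert_sym[OF R_A[of i t]] in \<open>simp_all add: A_norm R_norm\<close>)

lemma B9_V: "1 \<le> i \<Longrightarrow> i \<le> t \<Longrightarrow> cert t (5, 2) (v i, 3)"
proof -
  have "cert t (u (Suc t), 3) (v i, 1)" by (simp add: A_norm cert_col)
  then have "cert t (u (Suc t), 1) (v i, 3)" by (rule cert_swap) simp_all
  then show ?thesis by (simp add: seed_norm)
qed

lemma B9_R: "1 \<le> i \<Longrightarrow> i \<le> t \<Longrightarrow> cert t (5, 2) (u i, 4)"
proof -
  assume *: "1 \<le> i" "i \<le> t"
  then have "cert t (u (Suc t), 4) (u i, 1)" by (simp add: W_A)
  then have "cert t (u (Suc t), 1) (u i, 4)" by (rule cert_swap) (use * in simp_all)
  then show ?thesis by (simp add: seed_norm)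
qed

end

section \<open>Carrying the chain past the seed\<close>

lemma seed_rule:
  assumes "p \<in> set seed_cells" "q \<in> set seed_cells"
    "(p, q) \<notin> set open_pairs" "(q, p) \<notin> set open_pairs"
  shows "cert t p q"
  using seed_known[of t] assms by blast

text \<open>The seed cells that are left out when the statement about \<open>A\<^sub>i\<close>, respectively \<open>S\<^sub>i\<close>, is
carried up the chain. The sets are chosen as small as the step from \<open>i\<close> to \<open>i + 1\<close> permits when
it starts from \<open>open_pairs\<close>.\<close>

definition A_open :: "cell set" where "A_open = {(4, 2), (5, 4), (6, 2)}"

definition S_open :: "cell set" where "S_open = {(1, 3), (5, 4), (6, 4), (7, 4), (9, 4), (11, 4)}"

lemma window_edge:
  assumes "1 \<le> i" "i \<le> t"
  shows "edge t (u i, 2) = {(u i, 2)}" "edge t (v i, 3) = {(v i, 3)}"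
  using assms by (simp_all add: edge_def lab_u lab_v)

lemma W_edge: "edge t (u (Suc t), 4) = {(u (Suc t), 4)}"
  by (simp add: edge_def lab_last)

lemma u_neq_seed [simp]: "i \<le> 14 \<Longrightarrow> u (Suc k) \<noteq> i" "i \<le> 14
    \<Longrightarrow> i \<noteq> u (Suc k)"
  "i \<le> 14 \<Longrightarrow> v (Suc k) \<noteq> i" "i \<le> 14 \<Longrightarrow> i \<noteq> v (Suc k)"
  by (auto simp: u_def v_def)

text \<open>What is known about the chain, in the form in which it is used for rectangles with one seed
row. The row \<open>u 0\<close> appears there as row 2, and \<open>v 0\<close> as row 3.\<close>

lemmas param = R_S R_A U_A V_S A_V S_U U_V U_R V_R W_A W_S W_U W_V B9_V B9_R cert_row cert_col

lemma u_v_0: "u 0 = 2" "v 0 = 3"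
  by (simp_all add: u_def v_def)

lemmas param_start = R_A[where j = 0, unfolded u_v_0, OF _ _ le0]
  R_S[where j = 0, unfolded u_v_0, OF _ _ le0]
  U_A[where j = 0, unfolded u_v_0, OF _ _ le0] V_S[where j = 0, unfolded u_v_0, OF _ _ le0]
  W_A[where i = 0, unfolded u_v_0, OF le0] W_S[where i = 0, unfolded u_v_0, OF le0]

text \<open>Those open pairs that are taken from the last row; the others are derived from the statement
about \<open>A\<^sub>0\<close> and \<open>S\<^sub>0\<close> at the bottom of the chain.\<close>

definition late_pairs :: "(cell \<times> cell) list" where
  "late_pairs = [
    ((3, 2), (5, 4)), ((3, 4), (5, 2)), ((5, 1), (13, 4)), ((5, 1), (14, 4)),
    ((5, 2), (6, 4)), ((5, 2), (11, 4)), ((5, 2), (13, 4)), ((5, 3), (6, 4)),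
    ((5, 4), (6, 2)), ((5, 4), (6, 3)), ((5, 4), (13, 1)), ((6, 2), (12, 4))]"

lemmas window_rules = param param_start param[THEN cert_sym] param_start[THEN cert_sym]
  cert_hole cert_near seed_cells_def A_open_def S_open_def late_pairs_def

lemmas seed_rules = seed_rule open_pairs_def

text \<open>The rectangles use the rows \<open>u\<^sub>k\<^sub>+\<^sub>1\<close>, \<open>v\<^sub>k\<^sub>+\<^sub>1\<close> and one seed row. The edges \<open>A\<^sub>k\<close> and \<open>S\<^sub>k\<close>
occur in these rows in columns 3 and 2, which is how the hypotheses enter. As in the layers
of the seed, every list depends only on the preceding ones.\<close>

lemma step_up:
  assumes "Suc k \<le> t"
    and A: "\<forall>x \<in> set seed_cells. x \<notin> A_open \<longrightarrow> cert t (u k, 1) x"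
    and S: "\<forall>x \<in> set seed_cells. x \<notin> S_open \<longrightarrow> cert t (v k, 1) x"
  shows "\<forall>x \<in> set seed_cells. x \<notin> A_open \<longrightarrow> cert t (u (Suc k), 1) x"
    "\<forall>x \<in> set seed_cells. x \<notin> S_open \<longrightarrow> cert t (v (Suc k), 1) x"
proof -
  have le: "k \<le> t" "k < t" "1 \<le> Suc k" using assms(1) by simp_all
  note norm = seed_norm A_norm[OF le(1)] S_norm(1,2)[OF le(2)] R_norm[OF le(3) assms(1)]
  note edges = seed_edge A_edge[OF le(1)] A_edge[OF assms(1)] S_edge[OF le(1)] S_edge[OF assms(1)]
    R_edge[OF le(3) assms(1)] window_edge[OF le(3) assms(1)]
  note given = assms(1) A[rule_format] S[rule_format]
    A[rule_format, THEN cert_sym] S[rule_format, THEN cert_sym]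
  have l1:
     "cert t (1, 1) (v (Suc k), 4)" "cert t (2, 2) (u (Suc k), 1)"
     "cert t (3, 4) (u (Suc k), 1)" "cert t (4, 3) (u (Suc k), 4)"
     "cert t (12, 3) (u (Suc k), 2)" "cert t (4, 2) (v (Suc k), 4)"
     "cert t (11, 3) (u (Suc k), 4)" "cert t (10, 4) (u (Suc k), 1)"
     "cert t (14, 3) (u (Suc k), 4)" "cert t (12, 4) (u (Suc k), 1)"
     "cert t (13, 2) (v (Suc k), 4)" "cert t (3, 2) (v (Suc k), 4)"
     "cert t (2, 3) (v (Suc k), 1)" "cert t (3, 3) (v (Suc k), 1)"
     "cert t (3, 4) (v (Suc k), 1)" "cert t (7, 3) (v (Suc k), 1)"
     "cert t (10, 4) (v (Suc k), 1)" "cert t (12, 4) (v (Suc k), 1)"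
    by (rule cert_rect, simp, simp, simp add: norm edges given window_rules seed_rules le)+
  note k1 = l1[simplified norm] l1[simplified norm, THEN cert_sym]
  have l2:
     "cert t (1, 4) (u (Suc k), 1)" "cert t (6, 4) (u (Suc k), 1)"
     "cert t (7, 2) (u (Suc k), 1)" "cert t (4, 4) (u (Suc k), 2)"
     "cert t (9, 4) (u (Suc k), 1)" "cert t (11, 4) (u (Suc k), 1)"
     "cert t (13, 4) (u (Suc k), 1)" "cert t (14, 4) (u (Suc k), 1)"
     "cert t (13, 4) (v (Suc k), 1)" "cert t (14, 4) (v (Suc k), 1)"
    by (rule cert_rect, simp, simp, simp add: norm edges given window_rules seed_rules le k1)+
  note k2 = l2[simplified norm] l2[simplified norm, THEN cert_sym]
  have l3:
     "cert t (8, 2) (u (Suc k), 1)"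
    by (rule cert_rect, simp, simp, simp add: norm edges given window_rules seed_rules le k1 k2)+
  note k3 = l3[simplified norm] l3[simplified norm, THEN cert_sym]
  show "\<forall>x \<in> set seed_cells. x \<notin> A_open \<longrightarrow> cert t (u (Suc k), 1) x"
    "\<forall>x \<in> set seed_cells. x \<notin> S_open \<longrightarrow> cert t (v (Suc k), 1) x"
    by (simp_all add: norm edges given window_rules le k1 k2 k3 assms(1))
qed

text \<open>The same two rows, now read in the other direction. The cell \<open>(6, 4)\<close> against \<open>S\<^sub>k\<close> is
postponed to \<open>S_seed\<close>.\<close>

lemma step_down:
  assumes "Suc k \<le> t"
    and A: "\<forall>x \<in> set seed_cells. x \<notin> A_open \<longrightarrow> cert t (u k, 1) x"
    and S: "\<forall>x \<in> set seed_cells. x \<notin> S_open \<longrightarrow> cert t (v k, 1) x"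
    and A': "\<forall>x \<in> set seed_cells. cert t (u (Suc k), 1) x"
    and S': "\<forall>x \<in> set seed_cells. x \<notin> {(6, 4)} \<longrightarrow> cert t (v (Suc k), 1) x"
  shows "\<forall>x \<in> set seed_cells. cert t (u k, 1) x"
    "\<forall>x \<in> set seed_cells. x \<notin> {(6, 4)} \<longrightarrow> cert t (v k, 1) x"
proof -
  have le: "k \<le> t" "k < t" "1 \<le> Suc k" using assms(1) by simp_all
  note norm = seed_norm A_norm[OF le(1)] S_norm(1,2)[OF le(2)] R_norm[OF le(3) assms(1)]
  note edges = seed_edge A_edge[OF le(1)] A_edge[OF assms(1)] S_edge[OF le(1)] S_edge[OF assms(1)]
    R_edge[OF le(3) assms(1)] window_edge[OF le(3) assms(1)]
  note given = assms(1) A[rule_format] S[rule_format]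
    A[rule_format, THEN cert_sym] S[rule_format, THEN cert_sym]
    A'[rule_format] S'[rule_format]
    A'[rule_format, THEN cert_sym] S'[rule_format, THEN cert_sym]
  have l1:
     "cert t (6, 1) (u (Suc k), 2)" "cert t (12, 2) (v (Suc k), 4)"
     "cert t (6, 2) (u (Suc k), 3)" "cert t (1, 3) (u (Suc k), 4)"
     "cert t (5, 4) (v (Suc k), 2)" "cert t (8, 3) (u (Suc k), 2)"
     "cert t (10, 3) (u (Suc k), 4)" "cert t (6, 3) (u (Suc k), 4)"
    by (rule cert_rect, simp, simp, simp add: norm edges given window_rules seed_rules le)+
  note k1 = l1[simplified norm] l1[simplified norm, THEN cert_sym]
  have l2:
     "cert t (4, 2) (u (Suc k), 3)" "cert t (5, 4) (u (Suc k), 3)"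
     "cert t (1, 4) (v (Suc k), 3)" "cert t (7, 2) (u (Suc k), 4)"
     "cert t (9, 4) (v (Suc k), 2)" "cert t (11, 4) (v (Suc k), 2)"
    by (rule cert_rect, simp, simp, simp add: norm edges given window_rules seed_rules le k1)+
  note k2 = l2[simplified norm] l2[simplified norm, THEN cert_sym]
  have l3:
     "cert t (1, 3) (v (Suc k), 2)" "cert t (7, 4) (v (Suc k), 2)"
    by (rule cert_rect, simp, simp, simp add: norm edges given window_rules seed_rules le k1 k2)+
  note k3 = l3[simplified norm] l3[simplified norm, THEN cert_sym]
  show "\<forall>x \<in> set seed_cells. cert t (u k, 1) x"
    "\<forall>x \<in> set seed_cells. x \<notin> {(6, 4)} \<longrightarrow> cert t (v k, 1) x"
    by (simp_all add: norm edges given window_rules le k1 k2 k3)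
qed

text \<open>The last row contains \<open>A\<^sub>t\<close>, \<open>S\<^sub>t\<close> and \<open>B\<^sub>9\<close> together. Its rectangles link the open cells of
\<open>A\<^sub>t\<close> and \<open>S\<^sub>t\<close> with each other and with open pairs of the seed, and so close all gaps that the
upward induction leaves, except for \<open>S\<^sub>t\<close> against \<open>(6, 4)\<close>.\<close>

lemma last_row:
  assumes A: "\<forall>x \<in> set seed_cells. x \<notin> A_open \<longrightarrow> cert t (u t, 1) x"
    and S: "\<forall>x \<in> set seed_cells. x \<notin> S_open \<longrightarrow> cert t (v t, 1) x"
  shows "\<forall>x \<in> set seed_cells. cert t (u t, 1) x"
    "\<forall>x \<in> set seed_cells. x \<notin> {(6, 4)} \<longrightarrow> cert t (v t, 1) x"
    "\<forall>(p, q) \<in> set late_pairs. cert t p q"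
proof -
  have le: "t \<le> t" by simp
  note norm = seed_norm A_norm[OF le] S_norm(3,4)
  note edges = seed_edge A_edge[OF le] S_edge[OF le] W_edge
  note given = A[rule_format] S[rule_format]
    A[rule_format, THEN cert_sym] S[rule_format, THEN cert_sym]
  have l1:
     "cert t (4, 2) (u (Suc t), 3)" "cert t (12, 2) (u (Suc t), 4)"
     "cert t (6, 2) (u (Suc t), 3)" "cert t (1, 3) (u (Suc t), 2)"
     "cert t (5, 4) (u (Suc t), 2)" "cert t (8, 3) (u (Suc t), 2)"
     "cert t (10, 3) (u (Suc t), 4)" "cert t (6, 3) (u (Suc t), 4)"
     "cert t (3, 4) (u (Suc t), 1)" "cert t (13, 2) (u (Suc t), 4)"
     "cert t (4, 3) (u (Suc t), 4)" "cert t (14, 3) (u (Suc t), 4)"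
    by (rule cert_rect, simp, simp, simp add: norm edges given window_rules seed_rules le)+
  note k1 = l1[simplified norm] l1[simplified norm, THEN cert_sym]
  have l2:
     "cert t (5, 4) (u (Suc t), 3)" "cert t (9, 4) (u (Suc t), 2)"
     "cert t (11, 4) (u (Suc t), 2)" "cert t (3, 2) (5, 4)" "cert t (13, 4) (u (Suc t), 1)"
     "cert t (6, 4) (u (Suc t), 1)" "cert t (11, 4) (u (Suc t), 1)"
    by (rule cert_rect, simp, simp, simp add: norm edges given window_rules seed_rules le k1)+
  note k2 = l2[simplified norm] l2[simplified norm, THEN cert_sym]
  have l3:
     "cert t (5, 4) (13, 2)" "cert t (5, 1) (14, 4)" "cert t (5, 4) (11, 2)"
     "cert t (5, 4) (6, 2)"
    by (rule cert_rect, simp, simp, simp add: norm edges given window_rules seed_rules le k1 k2)+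
  note k3 = l3[simplified norm] l3[simplified norm, THEN cert_sym]
  have l4:
     "cert t (5, 1) (13, 4)" "cert t (5, 3) (6, 4)"
    by (rule cert_rect, simp, simp, simp add: norm edges given window_rules seed_rules le k1 k2 k3)+
  note k4 = l4[simplified norm] l4[simplified norm, THEN cert_sym]
  have l5:
     "cert t (6, 2) (12, 4)"
    by (rule cert_rect, simp, simp, simp add: norm edges given window_rules seed_rules le k1 k2 k3 k4)+
  note k5 = l5[simplified norm] l5[simplified norm, THEN cert_sym]
  show "\<forall>x \<in> set seed_cells. cert t (u t, 1) x"
    "\<forall>x \<in> set seed_cells. x \<notin> {(6, 4)} \<longrightarrow> cert t (v t, 1) x"
    by (simp_all add: norm edges given window_rules le k1 k2 k3 k4 k5)
  show "\<forall>(p, q) \<in> set late_pairs. cert t p q"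
    by (simp add: norm edges given window_rules le k1 k2 k3 k4 k5)
qed

text \<open>Rows 2 and 3 carry \<open>A\<^sub>0\<close> and \<open>S\<^sub>0\<close>, so the result of the downward induction is itself a
statement about pairs of seed edges.\<close>

lemma seed_complete:
  assumes A: "\<forall>x \<in> set seed_cells. cert t (u 0, 1) x"
    and S: "\<forall>x \<in> set seed_cells. x \<notin> {(6, 4)} \<longrightarrow> cert t (v 0, 1) x"
    and L: "\<forall>(p, q) \<in> set late_pairs. cert t p q"
  shows "\<forall>x \<in> set seed_cells. \<forall>y \<in> set seed_cells. cert t x y"
proof -
  have A0: "cert t (2, 1) x" if "x \<in> set seed_cells" for x
    using A that by (simp add: u_def)
  have S0: "cert t (3, 1) x" if "x \<in> set seed_cells" "x \<noteq> (6, 4)" for x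
    using S that by (simp add: v_def)
  have late: "cert t p q" if "(p, q) \<in> set late_pairs" for p q
    using L that by blast
  note norm = seed_norm
  note edges = seed_edge
  have le: "0 \<le> t" by simp
  note given = A0 S0 A0[THEN cert_sym] S0[THEN cert_sym] late late[THEN cert_sym]
  have l1:
     "cert t (1, 1) (3, 3)" "cert t (2, 2) (4, 1)" "cert t (2, 2) (6, 1)" "cert t (3, 3) (8, 1)"
     "cert t (3, 4) (9, 1)" "cert t (3, 4) (7, 1)" "cert t (3, 4) (11, 1)"
     "cert t (3, 4) (5, 1)"
    by (rule cert_rect, simp, simp, simp add: norm edges given window_rules seed_rules le)+
  note k1 = l1[simplified norm] l1[simplified norm, THEN cert_sym]
  have l2:
     "cert t (2, 3) (4, 2)" "cert t (3, 4) (4, 3)" "cert t (3, 3) (11, 4)"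
     "cert t (3, 3) (12, 4)" "cert t (3, 3) (14, 4)"
    by (rule cert_rect, simp, simp, simp add: norm edges given window_rules seed_rules le k1)+
  note k2 = l2[simplified norm] l2[simplified norm, THEN cert_sym]
  have l3:
     "cert t (3, 1) (6, 4)"
    by (rule cert_rect, simp, simp, simp add: norm edges given window_rules seed_rules le k1 k2)+
  note k3 = l3[simplified norm] l3[simplified norm, THEN cert_sym]
  have "\<forall>(p, q) \<in> set open_pairs. cert t p q"
    by (simp add: open_pairs_def norm edges given window_rules le k1 k2 k3)
  then show ?thesis using seed_rule cert_sym by blast
qed

section \<open>Chain against seed\<close>

lemma partial_seed:
  assumes "k \<le> t"
  shows "(\<forall>x \<in> set seed_cells. x \<notin> A_open \<longrightarrow> cert t (u k, 1) x) \<and>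
    (\<forall>x \<in> set seed_cells. x \<notin> S_open \<longrightarrow> cert t (v k, 1) x)"
  using assms
proof (induction k)
  case 0
  have "\<forall>x \<in> set seed_cells. x \<notin> A_open \<longrightarrow>
      ((2, 1), x) \<notin> set open_pairs \<and> (x, (2, 1)) \<notin> set open_pairs"
    "\<forall>x \<in> set seed_cells. x \<notin> S_open \<longrightarrow>
      ((3, 1), x) \<notin> set open_pairs \<and> (x, (3, 1)) \<notin> set open_pairs"
    "(2, 1) \<in> set seed_cells" "(3, 1) \<in> set seed_cells"
    by (simp_all add: seed_cells_def open_pairs_def A_open_def S_open_def)
  then show ?case unfolding u_v_0 using seed_rule by blast
next
  case (Suc k)
  then show ?case using step_up[of k t] by simp
qed

lemma almost_seed:
  assumes "k \<le> t"
  shows "(\<forall>x \<in> set seed_cells. cert t (u k, 1) x) \<and>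
    (\<forall>x \<in> set seed_cells. x \<notin> {(6, 4)} \<longrightarrow> cert t (v k, 1) x)"
  using assms
proof (induction k rule: inc_induct)
  case base
  note P = conjunct1[OF partial_seed[OF order_refl]] conjunct2[OF partial_seed[OF order_refl]]
  show ?case by (intro conjI last_row(1,2)[OF P])
next
  case (step k)
  have k: "Suc k \<le> t" using step.hyps by simp
  note P = conjunct1[OF partial_seed[of k t]] conjunct2[OF partial_seed[of k t]]
  note I = conjunct1[OF step.IH] conjunct2[OF step.IH]
  show ?case by (intro conjI step_down[OF k P(1) P(2) I]) (use k in simp_all)
qed

lemma seed_seed: "p \<in> set seed_cells \<Longrightarrow> q \<in> set seed_cells
    \<Longrightarrow> cert t p q"
  using seed_complete[OF conjunct1[OF almost_seed[OF le0]] conjunct2[OF almost_seed[OF le0]]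
    last_row(3)[OF conjunct1[OF partial_seed[OF order_refl]] conjunct2[OF partial_seed[OF order_refl]]]]
  by blast

lemma A_seed: "i \<le> t \<Longrightarrow> p \<in> set seed_cells \<Longrightarrow> cert t (u i, 1) p"
  using almost_seed by blast

text \<open>The pair with \<open>(6, 4)\<close> becomes available only now: for \<open>i = 0\<close> it is a pair of seed edges,
and for \<open>i > 0\<close> it follows from \<open>B\<^sub>6\<close>, \<open>R\<^sub>i\<close> in the rows \<open>v\<^sub>i\<close> and 6.\<close>

lemma S_seed:
  assumes "i \<le> t" "p \<in> set seed_cells"
  shows "cert t (v i, 1) p"
proof (cases "p = (6, 4)")
  case True
  show ?thesis
  proof (cases i)
    case 0
    then show ?thesis using seed_seed[of "(3, 1)" p t] assms by (simp add: u_v_0 seed_cells_def)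
  next
    case (Suc k)
    have "cert t (u k, 1) (4, 4)" using A_seed[of k t "(4, 4)"] Suc assms by (simp add: seed_cells_def)
    then have "cert t (u (Suc k), 3) (4, 4)" using Suc assms by (simp add: A_norm)
    then have "cert t (u (Suc k), 4) (4, 3)" by (rule cert_swap) simp_all
    then have "cert t (v (Suc k), 4) (6, 1)" using Suc assms by (simp add: R_norm seed_norm)
    then have "cert t (v (Suc k), 1) (6, 4)" by (rule cert_swap) simp_all
    then show ?thesis using Suc True by simp
  qed
next
  case False
  then show ?thesis using almost_seed assms by blast
qed

lemma seed_extend:
  assumes "\<And>x. x \<in> set seed_cells \<Longrightarrow> cert t p x" "i \<in> {1, 2, 3, 4, 5, 6,
      7, 8, 9, 10, 11, 12, 13, 14}" "j \<in> {1, 2, 3, 4}"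
  shows "cert t p (i, j)"
proof -
  have "\<forall>i \<in> {1, 2, 3, 4, 5, 6, 7, 8, 9, 10, 11, 12, 13, 14}. \<forall>j \<in> {1, 2, 3,
      4}. cert t p (i, j)"
    by (simp add: seed_norm cert_hole assms(1) seed_cells_def)
  then show ?thesis using assms(2,3) by blast
qed

text \<open>A dot, an \<open>R\<^sub>k\<close> or \<open>W\<close> in column \<open>l\<close> of a chain row and a seed cell \<open>(i, j)\<close>: unless the columns
agree, the companion consists of the column \<open>j\<close> cell of the chain row and the seed cell \<open>(i, l)\<close>.
That chain cell belongs to an \<open>A\<close> or \<open>S\<close> edge or to \<open>B\<^sub>9\<close>, or else to an \<open>R\<close> edge, which takes
one more rectangle.\<close>

context
  fixes t i j k :: nat
  assumes ij: "i \<in> {1, 2, 3, 4, 5, 6, 7, 8, 9, 10, 11, 12, 13, 14}" "j \<in> {1, 2, 3, 4}"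
begin

lemma row_seed_u:
  assumes "1 \<le> k" "k \<le> t" "l \<in> {2, 4}"
  shows "cert t (u k, l) (i, j)"
proof -
  obtain k' where k': "k = Suc k'" using assms by (cases k) auto
  have ne: "u k \<noteq> i" "v k \<noteq> i" using ij(1) k' by auto
  have A: "cert t (u k, 1) (i, l)" "cert t (u k', 1) (i, l)" "cert t (v k', 1) (i,
      l)" if "l \<in> {1, 2, 3, 4}" for l
    using seed_extend[OF A_seed ij(1) that] seed_extend[OF S_seed ij(1) that] k' assms by simp_all
  have R2: "cert t (u k, 4) (i, 2)"
  proof -
    have "cert t (v k, 2) (i, 4)" using A(3)[of 4] assms k' by (simp add: S_norm)
    then have "cert t (v k, 4) (i, 2)" by (rule cert_swap) (use ne in simp_all)
    then show ?thesis using assms by (simp add: R_norm)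
  qed
  show ?thesis
  proof (cases "j = l \<or> l = 4 \<and> j = 2")
    case True
    then show ?thesis using R2 by (auto simp: cert_col)
  next
    case False
    then have "cert t (u k, j) (i, l)"
      using ij(2) assms(3) A[of 2] A[of 4] R2 assms(1,2) k' by (auto simp: A_norm)
    then show ?thesis by (rule cert_swap) (use ne False in auto)
  qed
qed

lemma row_seed_v:
  assumes "1 \<le> k" "k \<le> t"
  shows "cert t (v k, 3) (i, j)"
proof -
  obtain k' where k': "k = Suc k'" using assms by (cases k) auto
  have ne: "v k \<noteq> i" using ij(1) k' by auto
  have A: "cert t (v k, 1) (i, 3)" "cert t (v k', 1) (i, 3)" 
    using seed_extend[OF S_seed ij(1)] k' assms by simp_all
  have "cert t (u k', 1) (i, 4)" using seed_extend[OF A_seed ij(1)] k' assms by simp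
  then have "cert t (u k, 3) (i, 4)" using k' assms by (simp add: A_norm)
  then have R: "cert t (u k, 4) (i, 3)" by (rule cert_swap) (use ij(1) k' in auto)
  show ?thesis
  proof (cases "j = 3")
    case True
    then show ?thesis by (simp add: cert_col)
  next
    case False
    then have "cert t (v k, j) (i, 3)"
      using ij(2) A R assms k' by (auto simp: S_norm R_norm)
    then show ?thesis by (rule cert_swap) (use ne False in auto)
  qed
qed

lemma row_seed_w: "cert t (u (Suc t), 4) (i, j)"
proof -
  have ne: "u (Suc t) \<noteq> i" using ij(1) by auto
  have A: "cert t (u t, 1) (i, 4)" "cert t (v t, 1) (i, 4)" "cert t (5, 2) (i, 4)"
    using seed_extend[OF A_seed ij(1)] seed_extend[OF S_seed ij(1)] seed_extend[OF seed_seed ij(1)]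
    by (simp_all add: seed_cells_def)
  show ?thesis
  proof (cases "j = 4")
    case True
    then show ?thesis by (simp add: cert_col)
  next
    case False
    then have "cert t (u (Suc t), j) (i, 4)"
      using ij(2) A by (auto simp: S_norm A_norm seed_norm)
    then show ?thesis by (rule cert_swap) (use ne False in auto)
  qed
qed

end

section \<open>The closure condition\<close>

definition representatives :: "nat \<Rightarrow> cell set" where
  "representatives t = set seed_cells \<union> (\<lambda>i. (u i, 1)) ` {..t}
      \<union> (\<lambda>i. (v i, 1)) ` {..t} \<union>
     (\<lambda>i. (u i, 2)) ` {1..t} \<union> (\<lambda>i. (v i, 3)) ` {1..t}
         \<union> (\<lambda>i. (u i, 4)) ` {1..t} \<union>
     {(u (Suc t), 4)}"

lemma seed_coords:
  assumes "x \<in> set seed_cells"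
  obtains i j where "x = (i, j)" "i \<in> {1, 2, 3, 4, 5, 6, 7, 8, 9, 10, 11, 12, 13, 14}"
      "j \<in> {1, 2, 3, 4}"
proof -
  have "\<forall>x \<in> set seed_cells. fst x \<in> {1, 2, 3, 4, 5, 6, 7, 8, 9, 10, 11, 12, 13, 14}
      \<and> snd x \<in> {1, 2, 3, 4}"
    by (simp add: seed_cells_def)
  with assms that show thesis by (metis prod.collapse)
qed

lemma param_seed:
  assumes "p \<in> set seed_cells"
  shows "1 \<le> k \<Longrightarrow> k \<le> t \<Longrightarrow> cert t (u k, 2) p" "1 \<le> k
      \<Longrightarrow> k \<le> t \<Longrightarrow> cert t (u k, 4) p"
    "1 \<le> k \<Longrightarrow> k \<le> t \<Longrightarrow> cert t (v k, 3) p" "cert t (u (Suc t), 4) p"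
  using seed_coords[OF assms] row_seed_u[of _ _ k t 2] row_seed_u[of _ _ k t 4] row_seed_v row_seed_w
  by (metis insertI1 insertI2)+

lemma representatives_cert:
  assumes "p \<in> representatives t" "q \<in> representatives t"
  shows "cert t p q"
  using assms unfolding representatives_def
  by (elim UnE imageE singletonE; hypsubst?)
    (simp_all add: param param[THEN cert_sym] seed_seed A_seed S_seed param_seed
       A_seed[THEN cert_sym] S_seed[THEN cert_sym] param_seed[THEN cert_sym])

lemma cert_by_representatives:
  assumes r: "\<And>r. r \<in> representatives t \<Longrightarrow> cert t p r" and "q \<in> occ t"
  shows "cert t p q"
  using assms(2)
proof (cases rule: occ_cases)
  case (1 i j)
  have "cert t p x" if "x \<in> set seed_cells" for x using r that by (simp add: representatives_def)
  from seed_extend[OF this 1(2,3)] show ?thesis by (simp add: 1(1))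
next
  case (2 k j)
  then obtain k' where k': "k = Suc k'" by (cases k) auto
  have "cert t p (u k, 1)" "cert t p (u k', 1)" "cert t p (u k, 2)" "cert t p (u k, 4)"
    using 2 k' by (auto intro!: r simp: representatives_def)
  then show ?thesis using 2 k' by (auto simp: A_norm)
next
  case (3 k j)
  then obtain k' where k': "k = Suc k'" by (cases k) auto
  have "cert t p (v k, 1)" "cert t p (v k', 1)" "cert t p (v k, 3)" "cert t p (u k, 4)"
    using 3 k' by (auto intro!: r simp: representatives_def)
  then show ?thesis using 3 k' by (auto simp: S_norm R_norm)
next
  case (4 j)
  have "cert t p (5, 2)" "cert t p (v t, 1)" "cert t p (u t, 1)" "cert t p (u (Suc t), 4)"
    by (auto intro!: r simp: representatives_def seed_cells_def)
  then show ?thesis using 4 by (auto simp: A_norm S_norm seed_norm)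
qed

lemma cert_all: "p \<in> occ t \<Longrightarrow> q \<in> occ t \<Longrightarrow> cert t p q"
  by (meson representatives_cert cert_by_representatives cert_sym)

lemma linked_occ: "linked (reduced t) p q \<Longrightarrow> p \<in> occ t \<and> q \<in> occ t
    \<and> q \<in> edge t p"
proof -
  assume l: "linked (reduced t) p q"
  then obtain x where "x \<in> pair_labels t" "home t x = {p, q}"
    by (auto simp: linked_def reduced_def)
  then have "p \<in> occ t" "q \<in> occ t" using home_eq[of x t] by auto
  then show ?thesis using l linked_reduced by blast
qed

text \<open>A rule that introduces \<open>p \<sim> q\<close>, apart from the rules of an equivalence relation, asks for a linked
pair \<open>p, q\<close>. So the classes are contained in the supports of the selected edges. The trivial second part is
there for the simultaneous induction.\<close>

lemma sim_sound: "sim (reduced t) p q \<Longrightarrow> p \<in> occ t \<and> q \<in> edge t p"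
  and "perp (reduced t) p q \<Longrightarrow> True"
proof (induction rule: sim_perp.inducts)
  case (sim_refl p)
  then show ?case by (simp add: occupied_reduced edge_refl)
next
  case (sim_sym p q)
  then show ?case using edge_sym edge_in_occ by blast
next
  case (sim_trans p q r)
  then show ?case using edge_cong by blast
qed (use linked_occ in blast)+

lemma edge_class_reduced: "c \<in> occ t \<Longrightarrow> edge_class (reduced t) (edge t c) = edge t c"
proof (intro equalityI subsetI)
  fix q assume c: "c \<in> occ t" and "q \<in> edge_class (reduced t) (edge t c)"
  then obtain p where "p \<in> edge t c" "sim (reduced t) p q" by (auto simp: edge_class_def)
  then show "q \<in> edge t c" using sim_sound edge_cong[OF c] by blast
next
  fix q assume c: "c \<in> occ t" and q: "q \<in> edge t c"
  then have "sim (reduced t) q q" using edge_in_occ sim_refl occupied_reduced by blast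
  then show "q \<in> edge_class (reduced t) (edge t c)" using q by (auto simp: edge_class_def)
qed

lemma RW3_plus_reduced: "RW3_plus (reduced t)"
  unfolding RW3_plus_def
proof (intro conjI allI impI ballI)
  fix p q assume "{p, q} \<in> two_edges (reduced t)"
  then have "p \<in> occ t" "q \<in> occ t" "q \<in> edge t p" using linked_occ by (auto simp: linked_def)
  then show "sim (reduced t) p q" using cert_within_edge by (simp add: cert_def)
next
  show "inj_on (edge_class (reduced t)) (selected (reduced t))"
    by (rule inj_onI) (auto simp: selected_reduced edge_class_reduced)
next
  fix e f assume "e \<in> selected (reduced t)" "f \<in> selected (reduced t)" "e \<noteq> f"
  then obtain c d where cd: "c \<in> occ t" "d \<in> occ t" "e = edge t c" "f = edge t d"
    unfolding selected_reduced by blast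
  then have "d \<notin> edge t c" using edge_cong[of c t d] \<open>e \<noteq> f\<close> by auto
  then have "perp (reduced t) c d" using cert_all[OF cd(1,2)] cd by (simp add: cert_def)
  then show "\<exists>p \<in> e. \<exists>q \<in> f. perp (reduced t) p q" using cd edge_refl by blast
qed

section \<open>Sizes of the edge sets\<close>

lemma simple_reduced: "simple (reduced t)"
  unfolding simple_def selected_reduced
proof (intro ballI impI)
  fix e f assume "e \<in> edge t ` occ t" "f \<in> edge t ` occ t" "e \<noteq> f"
  then show "e \<inter> f = {}" using edge_cong by blast
qed

lemma augmented_reduced: "augmented_config (reduced t)"
proof -
  have "e \<subseteq> cells (reduced t) \<and> card e = 2" if e: "e \<in> two_edges (reduced t)" for e
  proof -
    obtain x where "x \<in> pair_labels t" "e = home t x" using e by (auto simp: reduced_def)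
    then show ?thesis
      using home_eq[of x t] home_lab(1)[of x t] by (auto simp: reduced_def cells_def occ_def)
  qed
  moreover have "one_edges (reduced t) \<subseteq> cells (reduced t)"
    by (auto simp: reduced_def cells_def occ_def)
  ultimately show ?thesis by (simp add: augmented_config_def)
qed

text \<open>Only the first six rows have two dots, each in a different pair of columns; this is why no
rectangle has four dots.\<close>

lemma dots_in_row:
  assumes "(i, j) \<in> occ t" "(i, l) \<in> occ t" "lab t (i, j) = Dot" "lab t (i, l) = Dot" "j < l"
  shows "(i, j, l) \<in> {(1, 1, 3), (2, 2, 3), (3, 3, 4), (4, 1, 2), (5, 1, 4), (6, 2, 4)}"
proof -
  have j: "j \<in> {1, 2, 3, 4}" and l: "l \<in> {1, 2, 3, 4}"
    using assms(1,2) col_cases by (auto simp: occ_def grid_def)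
  show ?thesis
    using assms(1)
  proof (cases rule: occ_cases)
    case (1 i' j')
    have "i = i'" using 1(1) by simp
    note i = 1(2)[folded this]
    have "\<forall>i \<in> {1, 2, 3, 4, 5, 6, 7, 8, 9, 10, 11, 12, 13, 14}. \<forall>j \<in> {1, 2,
        3, 4}. \<forall>l \<in> {1, 2, 3, 4}.
       j < l \<longrightarrow> lab t (i, j) = Dot \<longrightarrow> lab t (i, l) = Dot \<longrightarrow>
      (i, j, l) \<in> {(1, 1, 3), (2, 2, 3), (3, 3, 4), (4, 1, 2), (5, 1, 4), (6, 2, 4)}"
      by (simp add: seed_lab seed_rows_def)
    from this[THEN bspec, OF i, THEN bspec, OF j, THEN bspec, OF l] show ?thesis
      using assms(3-5) by blast
  next
    case (2 k)
    have i: "i = u k" using 2 by simp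
    have "\<forall>j \<in> {1, 2, 3, 4}. lab t (u k, j) = Dot \<longrightarrow> j = 2"
        using lab_u[OF 2(1,2)] by simp
    then have "j = 2" "l = 2" using j l assms(3,4) unfolding i by blast+
    with assms(5) show ?thesis by simp
  next
    case (3 k)
    have i: "i = v k" using 3 by simp
    have "\<forall>j \<in> {1, 2, 3, 4}. lab t (v k, j) = Dot \<longrightarrow> j = 3"
        using lab_v[OF 3(1,2)] by simp
    then have "j = 3" "l = 3" using j l assms(3,4) unfolding i by blast+
    with assms(5) show ?thesis by simp
  next
    case 4
    have i: "i = u (Suc t)" using 4 by simp
    have "\<forall>j \<in> {1, 2, 3, 4}. lab t (u (Suc t), j) = Dot \<longrightarrow> j = 4"
        using lab_last[of t] by simp
    then have "j = 4" "l = 4" using j l assms(3,4) unfolding i by blast+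
    with assms(5) show ?thesis by simp
  qed
qed

lemma C4_free_reduced: "C4_free (one_edges (reduced t))"
proof -
  have "i = k" if "j < l" "{(i, j), (k, l), (i, l), (k, j)} \<subseteq> one_edges (reduced t)" for i j k l
    using dots_in_row[of i j t l] dots_in_row[of k j t l] that by (auto simp: reduced_def)
  note same = this
  show ?thesis
    unfolding C4_free_def
  proof (intro notI, elim exE conjE)
    fix i k j l
    assume "i \<noteq> k" "j \<noteq> l" and E: "{(i, j), (k, l), (i, l), (k,
        j)} \<subseteq> one_edges (reduced t)"
    then consider "j < l" | "l < j" by linarith
    then show False
    proof cases
      case 1
      then show ?thesis using same[OF 1 E] \<open>i \<noteq> k\<close> by simp
    next
      case 2
      have "{(i, l), (k, j), (i, j), (k, l)} \<subseteq> one_edges (reduced t)" using E by simp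
      from same[OF 2 this] show ?thesis using \<open>i \<noteq> k\<close> by simp
    qed
  qed
qed

lemma finite_occ: "finite (occ t)"
  by (simp add: occ_def grid_def)

lemma card_occ: "card (occ t) = 59 + 8 * t"
proof -
  have "(10, 1) \<in> grid (15 + 2 * t) 4" by (simp add: grid_def)
  then show ?thesis by (simp add: occ_def grid_def card_cartesian_product)
qed

lemma finite_pair_labels: "finite (pair_labels t)"
  by (simp add: pair_labels_def)

lemma card_pair_labels: "card (pair_labels t) = 19 + 3 * t"
proof -
  define B :: "nat set" where "B = {1, 3, 5, 6, 7, 8, 9, 10, 11, 12, 13, 14, 15, 16, 18, 20, 21}"
  have "card B = 17" "finite B" by (simp_all add: B_def)
  moreover have "card (LB ` B) = card B" "card (LA ` {..t}) = Suc t" "card (LS ` {..t}) = Suc t"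
    "card (LR ` {1..t}) = t"
    by (subst card_image; simp add: inj_on_def)+
  moreover have "LB ` B \<inter> LA ` {..t} = {}" "(LB ` B \<union> LA ` {..t}) \<inter> LS ` {..t} = {}"
    "(LB ` B \<union> LA ` {..t} \<union> LS ` {..t}) \<inter> LR ` {1..t} = {}" by auto
  ultimately show ?thesis
    unfolding pair_labels_def B_def[symmetric] by (simp add: card_Un_disjoint)
qed

lemma home_disjoint: "x \<in> pair_labels t \<Longrightarrow> y \<in> pair_labels t
    \<Longrightarrow> x \<noteq> y \<Longrightarrow> home t x \<inter> home t y = {}"
  by (auto simp: home_eq)

lemma card_two_edges_reduced: "card (two_edges (reduced t)) = 19 + 3 * t"
proof -
  have "inj_on (home t) (pair_labels t)"
  proof (rule inj_onI, rule ccontr)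
    fix x y assume *: "x \<in> pair_labels t" "y \<in> pair_labels t" "home t x = home t y" "x \<noteq> y"
    then have "home t x = {}" using home_disjoint by blast
    then show False using home_lab(1)[OF *(1)] by simp
  qed
  then show ?thesis by (simp add: reduced_def card_image card_pair_labels)
qed

text \<open>The dots are the occupied cells that remain after the two-edges are removed.\<close>

lemma card_one_edges_reduced: "card (one_edges (reduced t)) = 21 + 2 * t"
proof -
  have "card (\<Union> (home t ` pair_labels t)) = (\<Sum>x \<in> pair_labels t. card (home t x))"
    by (rule card_UN_disjoint)
      (use finite_pair_labels home_disjoint home_eq finite_occ in \<open>auto intro: finite_subset[OF _ finite_occ]\<close>)
  also have "\<dots> = 38 + 6 * t" using home_lab(1) by (simp add: card_pair_labels)
  finally have "card (\<Union> (home t ` pair_labels t)) = 38 + 6 * t" .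
  moreover have "occ t = one_edges (reduced t) \<union> \<Union> (home t ` pair_labels t)"
    using occupied_reduced[of t] by (simp add: occupied_def reduced_def)
  moreover have "one_edges (reduced t) \<inter> \<Union> (home t ` pair_labels t) = {}"
    using Dot_notin_pair_labels[of t] by (auto simp: reduced_def home_eq)
  ultimately have "59 + 8 * t = card (one_edges (reduced t)) + (38 + 6 * t)"
    using card_occ[of t] finite_occ[of t] by (metis card_Un_disjoint finite_Un)
  then show ?thesis by simp
qed

section \<open>Identification with the deleted configuration\<close>

text \<open>For \<open>t = 0\<close> the matrix still has the labels \<open>B\<^sub>2\<close> and \<open>B\<^sub>4\<close> in the places of \<open>A\<^sub>0\<close> and
\<open>S\<^sub>0\<close>.\<close>

definition rename_start :: "nat \<Rightarrow> label \<Rightarrow> label" where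
  "rename_start t x = (if t = 0 \<and> x = LB 2 then LA 0 else if t = 0 \<and> x = LB 4 then LS 0 else x)"

definition unshift :: "nat \<Rightarrow> nat" where
  "unshift i = (if i < 12 then i else Suc i)"

lemma lab_unshift:
  assumes "1 \<le> i" "i \<le> 15 + 2 * t" "j \<in> {1, 2, 3, 4}"
  shows "rename_start t (K_label t (unshift i, j)) = lab t (i, j)"
  using assms(1,2)
proof (cases rule: row_cases)
  case 1
  have "\<forall>i \<in> {1, 2, 3, 4, 5, 6, 7, 8, 9, 10, 11, 12, 13, 14}. \<forall>j \<in> {1, 2, 3, 4}.
      rename_start t (K_label t (unshift i, j)) = lab t (i, j)"
    by (simp add: rename_start_def K_label_def K_row_def K0_rows_def unshift_def seed_lab seed_rows_def)
  with 1 assms(3) show ?thesis by blast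
next
  case (2 k)
  have "K_row t (unshift i) = [LA k, Dot, LA (k - 1), LR k]"
    using 2 by (auto simp: K_row_def unshift_def u_def)
  then show ?thesis using 2 assms(3) lab_u[of k t j] by (auto simp: K_label_def rename_start_def)
next
  case (3 k)
  have "unshift i = 15 + 2 * k" using 3 by (simp add: unshift_def v_def)
  then have "K_row t (unshift i) = [LS k, LS (k - 1), Dot, LR k]"
    using 3 by (auto simp: K_row_def; presburger)
  then show ?thesis using 3 assms(3) lab_v[of k t j] by (auto simp: K_label_def rename_start_def)
next
  case 4
  have "unshift i = 16 + 2 * t" using 4 by (simp add: unshift_def u_def)
  then show ?thesis using 4 assms(3) lab_last[of t j]
    by (auto simp: K_label_def rename_start_def K_row_def K0_rows_def)
qed

lemma K0_label: "c \<in> grid 16 4 \<Longrightarrow> K_label 0 c \<noteq> LA i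
    \<and> K_label 0 c \<noteq> LS i"
proof -
  assume c: "c \<in> grid 16 4"
  have r: "\<forall>r \<in> set K0_rows. length r = 4
      \<and> (\<forall>x \<in> set r. x \<noteq> LA i \<and> x \<noteq> LS i)" "length K0_rows = 16"
    by (simp_all add: K0_rows_def)
  moreover have "fst c - 1 < 16" "snd c - 1 < 4" using c by (auto simp: grid_def)
  ultimately have "K0_rows ! (fst c - 1) ! (snd c - 1) \<in> set (K0_rows ! (fst c - 1))"
    "K0_rows ! (fst c - 1) \<in> set K0_rows" by simp_all
  with r have "K0_rows ! (fst c - 1) ! (snd c - 1) \<noteq> LA i
      \<and> K0_rows ! (fst c - 1) ! (snd c - 1) \<noteq> LS i"
    by blast
  then show ?thesis by (simp add: K_label_def K_row_def)
qed

text \<open>The renaming could only identify \<open>B\<^sub>2\<close> with \<open>A\<^sub>0\<close> or \<open>B\<^sub>4\<close> with \<open>S\<^sub>0\<close>, but \<open>K\<^sub>0\<close> has no labels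
\<open>A\<^sub>0\<close> and \<open>S\<^sub>0\<close>.\<close>

lemma rename_start_inj:
  assumes "c \<in> grid (16 + 2 * t) 4" "d \<in> grid (16 + 2 * t) 4"
  shows "rename_start t (K_label t c) = rename_start t (K_label t d)
      \<longleftrightarrow> K_label t c = K_label t d"
  using assms K0_label[of c 0] K0_label[of d 0] by (auto simp: rename_start_def)

lemma rename_start_Dot: "rename_start t x = Dot \<longleftrightarrow> x = Dot"
  by (simp add: rename_start_def)

lemma K_row_12: "K_row t 12 = [LB 19, LB 17, LB 19, Dot]"
  by (simp add: K_row_def K0_rows_def)

lemma K_label_10_1: "K_label t (10, 1) = LB 17"
  by (simp add: K_label_def K_row_def K0_rows_def)

definition kept :: "nat \<Rightarrow> cell set" where
  "kept t = {c \<in> grid (16 + 2 * t) 4. fst c \<noteq> 12 \<and> c \<noteq> (10, 1)}"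

lemma shift_kept: "shift_row 12 ` kept t = occ t"
proof (intro equalityI subsetI)
  fix d assume "d \<in> shift_row 12 ` kept t"
  then show "d \<in> occ t"
    by (auto simp: kept_def occ_def grid_def shift_row_def split: if_splits)
next
  fix d assume d: "d \<in> occ t"
  obtain i j where ij: "d = (i, j)" by (cases d)
  have "d = shift_row 12 (unshift i, j)" using ij by (auto simp: shift_row_def unshift_def)
  moreover have "(unshift i, j) \<in> kept t"
    using d ij by (auto simp: kept_def occ_def grid_def unshift_def)
  ultimately show "d \<in> shift_row 12 ` kept t" by blast
qed

lemma lab_shift:
  assumes "c \<in> kept t"
  shows "lab t (shift_row 12 c) = rename_start t (K_label t c)"
proof -
  obtain i j where c: "c = (i, j)" by (cases c)
  define i' where "i' = fst (shift_row 12 c)"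
  have "i = unshift i'" "1 \<le> i'" "i' \<le> 15 + 2 * t" "1 \<le> j" "j \<le> 4"
    using assms c by (auto simp: kept_def grid_def i'_def unshift_def shift_row_def)
  then have "rename_start t (K_label t c) = lab t (i', j)"
    using lab_unshift[of i' t j] col_cases[of j] c by simp
  then show ?thesis by (simp add: i'_def c shift_row_def)
qed

lemma kept_iff:
  assumes "c \<in> grid (16 + 2 * t) 4" "K_label t c \<notin> {LB 17, LB 19}"
  shows "c \<in> kept t \<longleftrightarrow> c \<noteq> (12, 4)"
proof -
  obtain i j where c: "c = (i, j)" by (cases c)
  then have "j \<in> {1, 2, 3, 4}" using assms(1) col_cases by (auto simp: grid_def)
  then show ?thesis
    using assms c K_label_10_1[of t] K_row_12[of t] by (auto simp: kept_def K_label_def)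
qed

lemma K_edge_kept:
  assumes "x \<notin> {LB 17, LB 19}"
  shows "K_edge t x - {(12, 4)} = {c \<in> kept t. K_label t c = x}"
proof (rule set_eqI)
  fix c
  show "c \<in> K_edge t x - {(12, 4)} \<longleftrightarrow> c \<in> {c \<in> kept t. K_label t c = x}"
  proof (cases "c \<in> grid (16 + 2 * t) 4 \<and> K_label t c = x")
    case True
    then show ?thesis using kept_iff[of c t] assms by (simp add: K_edge_def)
  next
    case False
    then show ?thesis by (auto simp: K_edge_def kept_def)
  qed
qed

lemma shift_edge:
  assumes "x \<in> K_label t ` grid (16 + 2 * t) 4" "x \<notin> {Dot, LB 17, LB 19}"
  shows "shift_row 12 ` K_edge t x = home t (rename_start t x)" "rename_start t x \<in> pair_labels t"
proof -
  have kept: "K_edge t x = {c \<in> kept t. K_label t c = x}"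
  proof -
    have "K_label t (12, 4) = Dot" by (simp add: K_label_def K_row_12)
    then have "(12, 4) \<notin> K_edge t x" using assms(2) by (auto simp: K_edge_def)
    then show ?thesis using K_edge_kept[of x t] assms(2) by simp
  qed
  obtain c where c: "c \<in> K_edge t x" using assms(1) by (auto simp: K_edge_def)
  then have "c \<in> kept t" "K_label t c = x" using kept by auto
  then have o: "shift_row 12 c \<in> occ t" "lab t (shift_row 12 c) = rename_start t x"
    using shift_kept lab_shift by blast+
  moreover have "rename_start t x \<noteq> Dot" using assms(2) by (auto simp: rename_start_def)
  ultimately show n: "rename_start t x \<in> pair_labels t" using occ_home by metis
  have "shift_row 12 ` {c \<in> kept t. K_label t c = x} = {d \<in> occ t. lab t d = rename_start t x}"
  proof -
    have "K_label t d = x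
        \<longleftrightarrow> lab t (shift_row 12 d) = rename_start t x" if "d \<in> kept t" for d
      using rename_start_inj[of d t c] that lab_shift[OF that] \<open>c \<in> kept t\<close> \<open>K_label t c = x\<close>
      by (simp add: kept_def)
    then have "{c \<in> kept t. K_label t c = x} = {c \<in> kept t. lab t (shift_row 12 c) = rename_start t x}"
      by blast
    then show ?thesis unfolding shift_kept[symmetric] by blast
  qed
  then show "shift_row 12 ` K_edge t x = home t (rename_start t x)" using kept home_eq[OF n] by simp
qed

text \<open>An edge is determined by its label, so edges may be compared through labels. Deleting
\<open>B\<^sub>1\<^sub>7\<close> and \<open>B\<^sub>1\<^sub>9\<close> removes row 12 up to its dot, and the cell \<open>(10, 1)\<close>.\<close>

lemma config_eq:
  "remove_row 12 (delete_edges {(12, 4)} {K_edge t (LB 19), K_edge t (LB 17)} (K t)) = reduced t"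
proof -
  let ?L = "K_label t ` grid (16 + 2 * t) 4"
  have "K_edge t Dot - {(12, 4)} = {c \<in> kept t. K_label t c = Dot}"
    by (rule K_edge_kept) simp
  moreover have "K_label t c = Dot
      \<longleftrightarrow> lab t (shift_row 12 c) = Dot" if "c \<in> kept t" for c
    using lab_shift[OF that] rename_start_Dot by simp
  then have "{c \<in> kept t. K_label t c = Dot} = {c \<in> kept t. lab t (shift_row 12 c) = Dot}"
    by blast
  ultimately have one: "shift_row 12 ` (K_edge t Dot - {(12, 4)}) = {c \<in> occ t. lab t c = Dot}"
    unfolding shift_kept[symmetric] by blast
  have two: "(\<lambda>e. shift_row 12 ` e) ` (K_edge t ` (?L - {Dot}) - {K_edge t (LB 19),
      K_edge t (LB 17)})
      = home t ` pair_labels t" (is "?A = ?B")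
  proof (intro equalityI subsetI)
    fix e assume "e \<in> ?A"
    then obtain x where x: "x \<in> ?L" "x \<noteq> Dot" "K_edge t x \<noteq> K_edge t (LB 19)"
      "K_edge t x \<noteq> K_edge t (LB 17)" "e = shift_row 12 ` K_edge t x" by blast
    then have "x \<notin> {Dot, LB 17, LB 19}" by auto
    from shift_edge[OF x(1) this] show "e \<in> ?B" using x(5) by blast
  next
    fix e assume "e \<in> ?B"
    then obtain y where y: "y \<in> pair_labels t" "e = home t y" by blast
    then have "home t y \<noteq> {}" using home_lab(1)[OF y(1)] by auto
    then obtain d where "d \<in> occ t" "lab t d = y" using home_eq[OF y(1)] by auto
    then obtain c where c: "c \<in> kept t" "rename_start t (K_label t c) = y"
        using shift_kept lab_shift by (metis imageE)
    let ?x = "K_label t c"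
    have L: "?x \<in> ?L" using c by (simp add: kept_def)
    have "y \<notin> {Dot, LB 17, LB 19}" using y by (auto simp: pair_labels_def)
    then have x: "?x \<notin> {Dot, LB 17, LB 19}" using c(2) by (auto simp: rename_start_def)
    have "c \<in> K_edge t ?x" "c \<notin> K_edge t (LB 17)" "c \<notin> K_edge t (LB 19)"
      using c(1) x by (auto simp: K_edge_def kept_def)
    then have "K_edge t ?x \<noteq> K_edge t (LB 17)" "K_edge t ?x \<noteq> K_edge t (LB 19)" by blast+
    moreover have "e = shift_row 12 ` K_edge t ?x" using shift_edge(1)[OF L x] c(2) y(2) by simp
    ultimately show "e \<in> ?A" using L x by blast
  qed
  show ?thesis
    using one two by (simp add: remove_row_def delete_edges_def K_def reduced_def)
qed

section \<open>Upper bounds and extremality\<close>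

text \<open>Two cells with the same column and the same first column of their row span a rectangle, so
outside the first cells of the rows there is at most one cell for each of the six pairs of
columns.\<close>

lemma C4_free_card_le:
  assumes E: "E \<subseteq> grid m 4" and free: "C4_free E"
  shows "card E \<le> m + 6"
proof -
  have fin: "finite E" using E by (rule finite_subset) (simp add: grid_def)
  define least where "least i = Min {j. (i, j) \<in> E}" for i
  have fin_row: "finite {j. (i, j) \<in> E}" for i
    by (rule finite_subset[of _ "snd ` E"]) (use fin in force, use fin in simp)
  have least: "(i, least i) \<in> E" "least i \<le> j" if "(i, j) \<in> E" for i j
    using Min_in[OF fin_row[of i]] Min_le[OF fin_row[of i]] that by (auto simp: least_def)
  define F where "F = {c \<in> E. snd c = least (fst c)}"
  have "card F \<le> card {1..m}"
  proof (rule card_inj_on_le)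
    show "inj_on fst F" by (rule inj_onI) (auto simp: F_def prod_eq_iff)
    show "fst ` F \<subseteq> {1..m}" using E by (auto simp: F_def grid_def)
  qed simp
  then have F_le: "card F \<le> m" by simp
  define Q :: "(nat \<times> nat) set" where "Q = {(1, 2), (1, 3), (1, 4), (2, 3), (2, 4), (3, 4)}"
  have "card (E - F) \<le> card Q"
  proof (rule card_inj_on_le)
    show "inj_on (\<lambda>c. (least (fst c), snd c)) (E - F)"
    proof (rule inj_onI, rule ccontr)
      fix c d assume *: "c \<in> E - F" "d \<in> E - F" "(least (fst c), snd c) = (least (fst d),
          snd d)" "c \<noteq> d"
      obtain i j k where c: "c = (i, j)" and d: "d = (k, j)" using * by (cases c; cases d) auto
      have "i \<noteq> k" "j \<noteq> least i" "least k = least i" using * c d by (auto simp: F_def)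
      moreover have "(i, j) \<in> E" "(k, j) \<in> E" "(i, least i) \<in> E" "(k, least i) \<in> E"
        using * c d least(1)[of i j] least(1)[of k j] by auto
      ultimately show False using free unfolding C4_free_def by blast
    qed
    show "(\<lambda>c. (least (fst c), snd c)) ` (E - F) \<subseteq> Q"
    proof
      fix p assume "p \<in> (\<lambda>c. (least (fst c), snd c)) ` (E - F)"
      then obtain c where c: "c \<in> E - F" "p = (least (fst c), snd c)" by blast
      obtain i j where "c = (i, j)" by (cases c)
      with c have ij: "(i, j) \<in> E" "j \<noteq> least i" "p = (least i, j)" by (auto simp: F_def)
      then have "least i < j" "(i, least i) \<in> E" using least[of i j] by auto
      moreover from this ij have "1 \<le> least i" "j \<le> 4" using E by (auto simp: grid_def)
      ultimately show "p \<in> Q"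
        unfolding Q_def using ij(3) col_cases[of "least i"] col_cases[of j] by auto
    qed
  qed (simp add: Q_def)
  then have "card (E - F) \<le> 6" by (simp add: Q_def)
  moreover have "F \<subseteq> E" by (auto simp: F_def)
  then have "card E = card F + card (E - F)"
    using fin by (simp add: card_Diff_subset card_mono finite_subset)
  ultimately show ?thesis using F_le by simp
qed

lemma zarankiewicz_eq: "zarankiewicz (15 + 2 * t) 4 = 21 + 2 * t"
  unfolding zarankiewicz_def
proof (rule Max_eqI)
  show "finite {card E | E. E \<subseteq> grid (15 + 2 * t) 4 \<and> C4_free E}"
    by (rule finite_subset[of _ "card ` Pow (grid (15 + 2 * t) 4)"]) (auto simp: grid_def)
  fix n assume "n \<in> {card E | E. E \<subseteq> grid (15 + 2 * t) 4 \<and> C4_free E}"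
  then obtain E where "n = card E" "E \<subseteq> grid (15 + 2 * t) 4" "C4_free E" by blast
  then show "n \<le> 21 + 2 * t" using C4_free_card_le[of E "15 + 2 * t"] by simp
next
  have "one_edges (reduced t) \<subseteq> grid (15 + 2 * t) 4" by (auto simp: reduced_def occ_def)
  then have "one_edges (reduced t) \<subseteq> grid (15 + 2 * t) 4 \<and> C4_free (one_edges (reduced t))"
    by (simp add: C4_free_reduced)
  then show "21 + 2 * t \<in> {card E | E. E \<subseteq> grid (15 + 2 * t) 4 \<and> C4_free E}"
    unfolding card_one_edges_reduced[symmetric] by blast
qed

lemma simple_num_edges_le:
  assumes "augmented_config H" "simple H"
  shows "card (one_edges H) + 2 * card (two_edges H) \<le> nrows H * ncols H"
proof -
  have fin: "finite (cells H)" by (simp add: cells_def grid_def)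
  have two: "e \<subseteq> cells H" "card e = 2" if "e \<in> two_edges H" for e
    using assms(1) that by (auto simp: augmented_config_def)
  have one: "one_edges H \<subseteq> cells H" using assms(1) by (simp add: augmented_config_def)
  have "card (\<Union> (two_edges H)) = (\<Sum>e \<in> two_edges H. card e)"
  proof (rule card_Union_disjoint)
    show "pairwise disjnt (two_edges H)"
    proof (rule pairwiseI)
      fix e f assume "e \<in> two_edges H" "f \<in> two_edges H" "e \<noteq> f"
      then show "disjnt e f" using assms(2) unfolding disjnt_def simple_def selected_def by blast
    qed
    show "finite e" if "e \<in> two_edges H" for e by (rule finite_subset[OF two(1)[OF that] fin])
  qed
  also have "\<dots> = (\<Sum>e \<in> two_edges H. 2)" by (rule sum.cong[OF refl two(2)])
  finally have "card (\<Union> (two_edges H)) = 2 * card (two_edges H)" by simp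
  moreover have "one_edges H \<inter> \<Union> (two_edges H) = {}"
  proof (rule ccontr)
    assume "one_edges H \<inter> \<Union> (two_edges H) \<noteq> {}"
    then obtain c e where c: "c \<in> one_edges H" "e \<in> two_edges H" "c \<in> e" by blast
    have "{c} \<noteq> e" using two(2)[OF c(2)] by auto
    moreover have "{c} \<in> selected H" "e \<in> selected H" using c by (simp_all add: selected_def)
    ultimately have "{c} \<inter> e = {}" using assms(2) by (simp add: simple_def)
    then show False using c(3) by simp
  qed
  moreover have U: "\<Union> (two_edges H) \<subseteq> cells H" using two(1) by blast
  moreover have "finite (one_edges H)" "finite (\<Union> (two_edges H))"
    using finite_subset[OF one fin] finite_subset[OF U fin] by simp_all
  ultimately have "card (one_edges H) + 2 * card (two_edges H) = card (one_edges H
      \<union> \<Union> (two_edges H))"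
    by (simp add: card_Un_disjoint)
  also have "\<dots> \<le> card (cells H)" by (rule card_mono[OF fin Un_least[OF one U]])
  also have "\<dots> = nrows H * ncols H" by (simp add: cells_def grid_def)
  finally show ?thesis .
qed

lemma admissible_reduced: "admissible (reduced t)"
  unfolding admissible_def
  using augmented_reduced simple_reduced C4_free_reduced RW3_plus_reduced card_one_edges_reduced[of t] zarankiewicz_eq[of t]
  by (simp add: reduced_def)

lemma num_edges_reduced: "num_edges (reduced t) = 40 + 5 * t"
  using card_one_edges_reduced[of t] card_two_edges_reduced[of t] by (simp add: num_edges_def)

lemma z_RL_eq: "z_RL (15 + 2 * t) 4 = 40 + 5 * t"
  unfolding z_RL_def
proof (rule Max_eqI)
  let ?N = "{num_edges H | H. nrows H = 15 + 2 * t \<and> ncols H = 4 \<and> admissible H}"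
  show le: "n \<le> 40 + 5 * t" if n: "n \<in> ?N" for n
  proof -
    obtain H where H: "n = num_edges H" "nrows H = 15 + 2 * t" "ncols H = 4" "admissible H"
      using n by blast
    then have "card (one_edges H) = 21 + 2 * t" using zarankiewicz_eq[of t] by (simp add: admissible_def)
    moreover have "card (one_edges H) + 2 * card (two_edges H) \<le> 60 + 8 * t"
      using simple_num_edges_le[of H] H by (simp add: admissible_def)
    ultimately show ?thesis using H(1) by (simp add: num_edges_def)
  qed
  show "finite ?N" by (rule finite_subset[of _ "{..40 + 5 * t}"]) (use le in auto)
  have "nrows (reduced t) = 15 + 2 * t" "ncols (reduced t) = 4" by (simp_all add: reduced_def)
  then show "40 + 5 * t \<in> ?N" using admissible_reduced[of t] num_edges_reduced[of t] by force
qed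

theorem proposition4p10:
  fixes t :: nat
  defines "G \<equiv> remove_row 12
                 (delete_edges {(12, 4)} {K_edge t (LB 19), K_edge t (LB 17)} (K t))"
  shows "nrows G = 15 + 2 * t \<and> ncols G = 4 \<and>
         admissible G \<and>
         num_edges G = z_RL (15 + 2 * t) 4 \<and>
         card (holes G) = 1 \<and>
         num_edges G = 40 + 5 * t"
proof -
  have G: "G = reduced t" unfolding G_def by (rule config_eq)
  have "nrows G = 15 + 2 * t" "ncols G = 4" by (simp_all add: G reduced_def)
  moreover have "card (holes G) = 1" by (simp add: G holes_reduced)
  ultimately show ?thesis
    using admissible_reduced num_edges_reduced z_RL_eq by (simp add: G)
qed

end
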